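(* Let $X$ be a complex Banach space and let $(S(t))_{t\ge 0}$ be a non-degenerate integrated semigroup on $X$ with generator $A$. Then for all $t>0$: $$\left\{\int_0^t e^{\lambda s}\,ds : \lambda\in\sigma_{qF}(A)\right\}\subseteq \sigma_{qF}(S(t)).$$
   Context: Integrated semigroups: a family $(S(t))_{t\ge 0}$ of bounded linear operators on $X$ is an integrated semigroup if $S(0)=0$, $t\mapsto S(t)$ is strongly continuous on $[0,\infty)$, and $S(r)S(t)=\int_0^r (S(\tau+t)-S(\tau))\,d\tau=S(t)S(r)$ for all $r,t\ge 0$ (integrals taken strongly). It is non-degenerate if $\{x\in X: S(t)x=0\ \forall t\ge 0\}=\{0\}$. Let $C^1=\{x\in X: S(\cdot)x\in C^1(\mathbb{R}^+;X)\}$. The generator $A:D(A)\subseteq X\to X$ of a non-degenerate integrated semigroup is defined by: $x\in D(A)$ and $Ax=y$ iff $x\in C^1$ and $S'(t)x-x=S(t)y$ for all $t\ge 0$. It is a closed linear operator. For a closed linear operator $T$ on $X$, $R(T)$ is its range and $N(T)$ its null space ($T^0=I$). Let $\Delta(T)=\{n\in\mathbb{N}: \forall m\ge n,\ R(T^n)\cap N(T)=R(T^m)\cap N(T)\}$ (with $0\in\mathbb{N}$); the degree of stable iteration is $dis(T)=\inf\Delta(T)$, with $dis(T)=\infty$ if $\Delta(T)=\emptyset$. $T$ is quasi-Fredholm if there is $d\in\mathbb{N}$ such that (1) $dis(T)=d$; (2) $R(T^n)$ is closed in $X$ for all $n\ge d$; (3) $R(T)+N(T^n)$ is closed in $X$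 for all $n\ge d$. The quasi-Fredholm spectrum is $\sigma_{qF}(T)=\{\lambda\in\mathbb{C}: T-\lambda I\text{ is not quasi-Fredholm}\}$. *)

theory Defs
  imports "HOL-Analysis.Analysis" "HOL-Library.Extended_Nat"
begin

class complex_banach = banach +
  fixes scaleC :: "complex \<Rightarrow> 'a \<Rightarrow> 'a" (infixr "*\<^sub>C" 75)
  assumes scaleC_of_real: "complex_of_real r *\<^sub>C x = r *\<^sub>R x"
    and scaleC_add_right: "a *\<^sub>C (x + y) = a *\<^sub>C x + a *\<^sub>C y"
    and scaleC_add_left: "(a + b) *\<^sub>C x = a *\<^sub>C x + b *\<^sub>C x"
    and scaleC_scaleC: "a *\<^sub>C (b *\<^sub>C x) = (a * b) *\<^sub>C x"
    and norm_scaleC: "norm (a *\<^sub>C x) = cmod a * norm x"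

lemma vector_space_scaleC:
  "vector_space (scaleC :: complex \<Rightarrow> 'a::complex_banach \<Rightarrow> 'a)"
  using scaleC_of_real[of 1]
  by unfold_locales (simp_all add: scaleC_add_right scaleC_add_left scaleC_scaleC)

instantiation complex :: complex_banach
begin
definition "scaleC = ((*) :: complex \<Rightarrow> complex \<Rightarrow> complex)"
instance
  by standard (simp_all add: scaleC_complex_def scaleR_conv_of_real algebra_simps norm_mult)
end

definition bounded_clinear :: "('a::complex_banach \<Rightarrow> 'a) \<Rightarrow> bool" where
  "bounded_clinear f \<longleftrightarrow> bounded_linear f \<and> (\<forall>c x. f (c *\<^sub>C x) = c *\<^sub>C f x)"

text \<open>A possibly unbounded operator \<open>T : D(T) \<subseteq> X \<rightarrow> X\<close> is represented by its graph. Thus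
  \<open>D(T)\<close> and \<open>R(T)\<close> are \<^const>\<open>Domain\<close> and \<^const>\<open>Range\<close>, and \<open>T ^^ n\<close> is the \<open>n\<close>-th power
  with its natural domain, \<open>T ^^ 0\<close> being the identity on all of \<open>X\<close>.\<close>

type_synonym 'a operator = "('a \<times> 'a) set"

definition total_op :: "('a \<Rightarrow> 'a) \<Rightarrow> 'a operator" where
  "total_op f = {(x, f x) | x. True}"

definition null_space :: "'a::zero operator \<Rightarrow> 'a set" where
  "null_space T = {x. (x, 0) \<in> T}"

definition shift_op :: "'a::complex_banach operator \<Rightarrow> complex \<Rightarrow> 'a operator" where
  "shift_op T l = {(x, y - l *\<^sub>C x) | x y. (x, y) \<in> T}"

definition stable_indices :: "'a::complex_banach operator \<Rightarrow> nat set" where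
  "stable_indices T =
    {n. \<forall>m\<ge>n. Range (T ^^ n) \<inter> null_space T = Range (T ^^ m) \<inter> null_space T}"

definition dis :: "'a::complex_banach operator \<Rightarrow> enat" where
  "dis T = Inf (enat ` stable_indices T)"

lemma dis_eq_infinity: "stable_indices T = {} \<Longrightarrow> dis T = \<infinity>"
  by (simp add: dis_def Inf_enat_def)

definition quasi_Fredholm :: "'a::complex_banach operator \<Rightarrow> bool" where
  "quasi_Fredholm T \<longleftrightarrow> (\<exists>d::nat. dis T = enat d
     \<and> (\<forall>n\<ge>d. closed (Range (T ^^ n)))
     \<and> (\<forall>n\<ge>d. closed {u + v | u v. u \<in> Range T \<and> v \<in> null_space (T ^^ n)}))"

definition qF_spectrum :: "'a::complex_banach operator \<Rightarrow> complex set" where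
  "qF_spectrum T = {l. \<not> quasi_Fredholm (shift_op T l)}"

definition integrated_semigroup :: "(real \<Rightarrow> 'a::complex_banach \<Rightarrow> 'a) \<Rightarrow> bool" where
  "integrated_semigroup S \<longleftrightarrow>
     (\<forall>t\<ge>0. bounded_clinear (S t))
   \<and> (\<forall>x. S 0 x = 0)
   \<and> (\<forall>x. continuous_on {0..} (\<lambda>t. S t x))
   \<and> (\<forall>r\<ge>0. \<forall>t\<ge>0. \<forall>x.
        S r (S t x) = integral {0..r} (\<lambda>\<tau>. S (\<tau> + t) x - S \<tau> x)
      \<and> integral {0..r} (\<lambda>\<tau>. S (\<tau> + t) x - S \<tau> x) = S t (S r x))"

definition nondegenerate :: "(real \<Rightarrow> 'a::complex_banach \<Rightarrow> 'a) \<Rightarrow> bool" where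
  "nondegenerate S \<longleftrightarrow> {x. \<forall>t\<ge>0. S t x = 0} = {0}"

text \<open>Only the values \<open>S t\<close> for \<open>t \<ge> 0\<close> are meaningful, so derivatives are taken within \<open>{0..}\<close>
  (one-sided at \<open>0\<close>); the library's \<open>C1_differentiable_on\<close> would demand a two-sided derivative.\<close>

definition C1_vectors :: "(real \<Rightarrow> 'a::complex_banach \<Rightarrow> 'a) \<Rightarrow> 'a set" where
  "C1_vectors S = {x. \<exists>D. (\<forall>t\<ge>0. ((\<lambda>s. S s x) has_vector_derivative D t) (at t within {0..}))
                        \<and> continuous_on {0..} D}"

definition generator :: "(real \<Rightarrow> 'a::complex_banach \<Rightarrow> 'a) \<Rightarrow> 'a operator" where
  "generator S = {(x, y). x \<in> C1_vectors S
     \<and> (\<forall>t\<ge>0. vector_derivative (\<lambda>s. S s x) (at t within {0..}) - x = S t y)}"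

lemma single_valued_generator:
  assumes "integrated_semigroup S" "nondegenerate S"
  shows "single_valued (generator S)"
proof (rule single_valuedI)
  fix x y z assume yz: "(x, y) \<in> generator S" "(x, z) \<in> generator S"
  have "S t (y - z) = 0" if "t \<ge> 0" for t
  proof -
    have "linear (S t)"
      using assms(1) that
      by (simp add: integrated_semigroup_def bounded_clinear_def bounded_linear.linear)
    moreover have "S t y = S t z"
      using yz that unfolding generator_def by auto
    ultimately show ?thesis by (simp add: linear_diff)
  qed
  then have "y - z \<in> {0}"
    using assms(2) unfolding nondegenerate_def by blast
  then show "y = z" by simp
qed

end

theory Submission
  imports Defs
begin

text \<open>
  Fix \<open>l\<close> and \<open>t > 0\<close>, let \<open>T = A - l\<close>, \<open>\<mu> = \<integral>\<^sub>0\<^sup>t e\<^sup>l\<^sup>s ds\<close>, and write \<open>J\<^sub>0 = S\<close> and \<open>J\<^sub>n\<^sub>+\<^sub>1\<close>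
  for the convolution of \<open>J\<^sub>n\<close> with \<open>s \<mapsto> e\<^sup>l\<^sup>s\<close>. Then \<open>T J\<^sub>n\<^sub>+\<^sub>1(t) = J\<^sub>n(t) - j\<^sub>n(t)\<close> with scalar functions \<open>j\<^sub>n\<close>
  such that \<open>j\<^sub>0(t) = \<mu>\<close> and \<open>j\<^sub>1(t) + l j\<^sub>2(t) = t\<^sup>2 e\<^sup>l\<^sup>t / 2 \<noteq> 0\<close>. If \<open>j\<^sub>1(t) \<noteq> 0\<close>, then
  \<open>B = (S(t) - \<mu>) / j\<^sub>1(t)\<close> equals \<open>T E\<close> with \<open>E = J\<^sub>1(t) / j\<^sub>1(t)\<close>; otherwise
  \<open>B = (S(t) - \<mu>) / j\<^sub>2(t)\<close> equals \<open>T\<^sup>2 E\<close> with \<open>E = J\<^sub>2(t) / j\<^sub>2(t)\<close>. In both cases there is a bounded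
  \<open>F\<close> with \<open>E - T F = I\<close>, all operators commute, and \<open>B = T\<^sup>k E\<close>.

  In this situation \<open>E\<close> is the identity on \<open>N(T)\<close> and \<open>E x \<in> R(T\<^sup>n)\<close> implies \<open>x \<in> R(T\<^sup>n)\<close>, whence
  \<open>R(T\<^sup>k\<^sup>n) \<inter> N(T) = R(B\<^sup>n) \<inter> N(T)\<close>, and \<open>R(T\<^sup>k\<^sup>n)\<close> is closed if \<open>R(B\<^sup>n)\<close> is. Closedness descends from
  \<open>R(T\<^sup>n\<^sup>+\<^sup>1)\<close> to \<open>R(T\<^sup>n)\<close> for \<open>n \<ge> dis(T)\<close> by the open mapping theorem, and \<open>R(T) + N(T\<^sup>n)\<close> is the
  preimage of \<open>R(T\<^sup>n\<^sup>+\<^sup>1)\<close> under the bounded operator \<open>(T E)\<^sup>n\<close>.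
\<close>

section \<open>Open mappings for closed linear relations\<close>

text \<open>The limiting step shared by both halves of the open mapping argument: completeness is
  used for the first coordinates only, the second ones converge by hypothesis.\<close>

lemma closed_subspace_series:
  fixes G :: "('x::banach \<times> 'y::banach) set"
  assumes G: "subspace G" "closed G"
    and mem: "\<And>i. (x i, y i) \<in> G"
    and x: "summable (\<lambda>i. norm (x i))"
    and y: "(\<lambda>n. \<Sum>i<n. y i) \<longlonglongrightarrow> l"
  shows "(suminf x, l) \<in> G"
proof -
  have "(\<Sum>i<n. x i, \<Sum>i<n. y i) \<in> G" for n
    using subspace_sum[OF G(1), of "{..<n}" "\<lambda>i. (x i, y i)"] mem
    by (simp add: sum_prod)
  moreover have "(\<lambda>n. \<Sum>i<n. x i) \<longlonglongrightarrow> suminf x"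
    using x by (simp add: summable_LIMSEQ summable_norm_cancel)
  then have "(\<lambda>n. (\<Sum>i<n. x i, \<Sum>i<n. y i)) \<longlonglongrightarrow> (suminf x, l)"
    using y by (intro tendsto_Pair)
  ultimately show ?thesis
    using G(2) by (meson closed_sequentially)
qed

lemma summable_norm_if_le_geometric:
  fixes x :: "nat \<Rightarrow> 'x::real_normed_vector"
  assumes "\<And>i. norm (x i) \<le> c * (1/2)^i"
  shows "summable (\<lambda>i. norm (x i))"
proof (rule summable_comparison_test')
  show "summable (\<lambda>i. c * (1/2 :: real)^i)"
    by (intro summable_mult summable_geometric) simp
  show "norm (norm (x i)) \<le> c * (1/2)^i" if "i \<ge> 0" for i
    using assms[of i] by simp
qed

text \<open>The converse half of the open mapping theorem: a sequence in the range that converges at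
  a geometric rate is telescoped, each increment is lifted with the bound, and the lifts form an
  absolutely convergent series.\<close>

lemma closed_Range_if_bounded_preimages:
  fixes G :: "('x::banach \<times> 'y::banach) set"
  assumes G: "subspace G" "closed G"
    and K: "\<And>y. y \<in> Range G \<Longrightarrow> \<exists>x. (x, y) \<in> G \<and> norm x \<le> K * norm y"
  shows "closed (Range G)"
proof -
  have "l \<in> Range G" if l: "l \<in> closure (Range G)" for l
  proof -
    have K0: "\<exists>x. (x, y) \<in> G \<and> norm x \<le> \<bar>K\<bar> * norm y" if "y \<in> Range G" for y
      using K[OF that] by (meson abs_ge_self mult_right_mono norm_ge_zero order_trans)
    have "\<exists>y\<in>Range G. dist y l < (1/2)^i" for i :: nat
      using l by (simp add: closure_approachable)
    then obtain y where y: "\<And>i. y i \<in> Range G" "\<And>i. dist (y i) l < (1/2)^i"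
      by metis
    have "(y (Suc i) - y i) \<in> Range G" for i
    proof -
      obtain a b where "(a, y (Suc i)) \<in> G" "(b, y i) \<in> G"
        using y(1) by (meson RangeE)
      then have "(a - b, y (Suc i) - y i) \<in> G"
        using subspace_diff[OF G(1)] by fastforce
      then show ?thesis by blast
    qed
    then have "\<forall>i. \<exists>x. (x, y (Suc i) - y i) \<in> G \<and> norm x \<le> \<bar>K\<bar> * norm (y (Suc i) - y i)"
      using K0 by blast
    then obtain x where x: "\<And>i. (x i, y (Suc i) - y i) \<in> G"
        "\<And>i. norm (x i) \<le> \<bar>K\<bar> * norm (y (Suc i) - y i)"
      by metis
    have "norm (y (Suc i) - y i) \<le> 2 * (1/2)^i" for i
    proof -
      have "norm (y (Suc i) - y i) \<le> dist (y (Suc i)) l + dist (y i) l"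
        by (metis dist_norm dist_triangle2)
      also have "\<dots> \<le> (1/2)^Suc i + (1/2)^i"
        using y(2)[of i] y(2)[of "Suc i"] by linarith
      also have "\<dots> \<le> 2 * (1/2)^i" by simp
      finally show ?thesis .
    qed
    then have "norm (x i) \<le> \<bar>K\<bar> * (2 * (1/2)^i)" for i
      using x(2)[of i] by (meson abs_ge_zero mult_left_mono order_trans)
    then have "summable (\<lambda>i. norm (x i))"
      by (intro summable_norm_if_le_geometric[where c = "\<bar>K\<bar> * 2"]) (simp only: mult.assoc)
    moreover have "y \<longlonglongrightarrow> l"
    proof (rule metric_LIMSEQ_I)
      fix e :: real assume "e > 0"
      then obtain N where "(1/2)^N < e"
        using real_arch_pow_inv[of e "1/2"] by auto
      moreover have "(1/2)^n \<le> ((1/2)^N :: real)" if "n \<ge> N" for n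
        using that by (intro power_decreasing) auto
      ultimately have "dist (y n) l < e" if "n \<ge> N" for n
        using y(2)[of n] that by (meson less_le_trans less_trans order_le_less_trans)
      then show "\<exists>N. \<forall>n\<ge>N. dist (y n) l < e" by blast
    qed
    then have "(\<lambda>n. \<Sum>i<n. y (Suc i) - y i) \<longlonglongrightarrow> l - y 0"
      by (simp add: sum_lessThan_telescope tendsto_diff)
    ultimately have "(suminf x, l - y 0) \<in> G"
      by (rule closed_subspace_series[OF G x(1)])
    moreover obtain a where "(a, y 0) \<in> G"
      using y(1) by (meson RangeE)
    ultimately have "(suminf x + a, l - y 0 + y 0) \<in> G"
      using subspace_add[OF G(1)] by fastforce
    then show ?thesis by auto
  qed
  then show ?thesis
    by (metis closure_subset_eq subsetI)
qed

text \<open>The closures of the images of balls exhaust the closed range, so Baire gives one of them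
  an interior point; successive approximation then removes the closure. The relational form covers
  unbounded operators and relations with auxiliary parameters.\<close>

theorem open_mapping_closed_relation:
  fixes G :: "('x::banach \<times> 'y::banach) set"
  assumes G: "subspace G" "closed G" and R: "closed (Range G)"
  obtains K where "\<And>y. y \<in> Range G \<Longrightarrow> \<exists>x. (x, y) \<in> G \<and> norm x \<le> K * norm y"
proof -
  define Y where "Y n = {y. \<exists>x. (x, y) \<in> G \<and> norm x \<le> real n}" for n :: nat
  define X where "X = top_of_set (Range G)"
  have subR: "subspace (Range G)"
  proof -
    have "linear (snd :: 'x \<times> 'y \<Rightarrow> 'y)" by (rule linear_snd)
    from linear_subspace_image[OF this G(1)] show ?thesis
      by (simp add: Range_snd)
  qed
  have Ysub: "Y n \<subseteq> Range G" for n
    by (auto simp: Y_def)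
  have clY: "closure (Y n) \<subseteq> Range G" for n
    using Ysub R by (simp add: closure_minimal)
  have RY: "Range G = (\<Union>n. closure (Y n))"
  proof
    show "Range G \<subseteq> (\<Union>n. closure (Y n))"
    proof
      fix y assume "y \<in> Range G"
      then obtain x where "(x, y) \<in> G" by auto
      moreover obtain n where "norm x \<le> real n" using real_arch_simple by blast
      ultimately have "y \<in> Y n" by (auto simp: Y_def)
      then show "y \<in> (\<Union>n. closure (Y n))" using closure_subset by blast
    qed
  qed (use clY in auto)
  have "\<exists>n. X interior_of closure (Y n) \<noteq> {}"
  proof (rule ccontr)
    assume "\<not> ?thesis"
    then have e: "X interior_of closure (Y n) = {}" for n by auto
    have "completely_metrizable_space X"
      unfolding X_def using R completely_metrizable_space_closedin completely_metrizable_space_euclidean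
      by (metis closed_closedin)
    then have "X interior_of \<Union>(range (\<lambda>n. closure (Y n))) = {}"
    proof (intro Baire_category_alt)
      fix T assume "T \<in> range (\<lambda>n. closure (Y n))"
      then show "closedin X T \<and> X interior_of T = {}"
        using e closed_subset[OF clY closed_closure] unfolding X_def by auto
    qed auto
    then have "X interior_of (topspace X) = {}"
      using RY by (simp add: X_def)
    moreover have "0 \<in> topspace X"
      using subR by (simp add: X_def subspace_0)
    ultimately show False by (metis empty_iff interior_of_topspace)
  qed
  then obtain n y0 where "y0 \<in> X interior_of closure (Y n)" by auto
  then obtain U where U: "openin X U" "y0 \<in> U" "U \<subseteq> closure (Y n)"
    by (auto simp: interior_of_def)
  then obtain e where e: "e > 0" "\<And>y. y \<in> Range G \<Longrightarrow> dist y y0 < e \<Longrightarrow> y \<in> closure (Y n)"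
    unfolding X_def openin_euclidean_subtopology_iff by (metis subsetD)
  have y0: "y0 \<in> Range G"
    using U clY by blast
  \<comment> \<open>approximate preimages of small vectors, as differences of points near \<open>y0\<close>\<close>
  have approx: "\<exists>x z. (x, z) \<in> G \<and> norm x \<le> 2 * real n \<and> norm (y - z) < d"
    if y: "y \<in> Range G" "norm y < e" and d: "d > 0" for y d
  proof -
    have "y0 + y \<in> closure (Y n)"
      using e(2)[of "y0 + y"] y y0 subspace_add[OF subR] by (simp add: dist_norm)
    moreover have "y0 \<in> closure (Y n)"
      using e y0 by simp
    ultimately obtain a b where ab: "a \<in> Y n" "dist a (y0 + y) < d/2" "b \<in> Y n" "dist b y0 < d/2"
      using d by (metis closure_approachable half_gt_zero)
    obtain p where p: "(p, a) \<in> G" "norm p \<le> real n" using ab by (auto simp: Y_def)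
    obtain q where q: "(q, b) \<in> G" "norm q \<le> real n" using ab by (auto simp: Y_def)
    have "(p - q, a - b) \<in> G"
      using subspace_diff[OF G(1) p(1) q(1)] by simp
    moreover have "norm (p - q) \<le> 2 * real n"
      using norm_triangle_ineq4[of p q] p q by linarith
    moreover have "norm (y - (a - b)) < d"
    proof -
      have "y - (a - b) = (b - y0) - (a - (y0 + y))" by simp
      then have "norm (y - (a - b)) \<le> norm (b - y0) + norm (a - (y0 + y))"
        by (metis norm_triangle_ineq4)
      then show ?thesis using ab by (simp add: dist_norm)
    qed
    ultimately show ?thesis by blast
  qed
  \<comment> \<open>For \<open>y\<close> rescaled to norm \<open>e/2\<close>, \<open>approx\<close>
    with tolerance \<open>e/4\<close> halves the error; undoing the scaling turns
    \<open>2 * real n\<close> into \<open>M * norm y\<close>.\<close>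
  define M where "M = 4 * real n / e"
  have M0: "M \<ge> 0" using e by (simp add: M_def)
  have halve: "\<exists>x z. (x, z) \<in> G \<and> norm x \<le> M * norm y \<and> norm (y - z) \<le> norm y / 2"
    if y: "y \<in> Range G" for y
  proof (cases "y = 0")
    case True
    then show ?thesis using subspace_0[OF G(1)]
      by (intro exI[of _ 0]) (simp add: zero_prod_def)
  next
    case False
    define c where "c = e / (2 * norm y)"
    have c: "c > 0" using False e by (simp add: c_def)
    have "norm (c *\<^sub>R y) < e"
      using False e by (simp add: c_def)
    then obtain x z where xz: "(x, z) \<in> G" "norm x \<le> 2 * real n" "norm (c *\<^sub>R y - z) < e/4"
      using approx[of "c *\<^sub>R y" "e/4"] y e subspace_scale[OF subR] by auto
    have "((1/c) *\<^sub>R x, (1/c) *\<^sub>R z) \<in> G"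
      using subspace_scale[OF G(1) xz(1)] by simp
    moreover have "norm ((1/c) *\<^sub>R x) \<le> M * norm y"
    proof -
      have "norm ((1/c) *\<^sub>R x) = norm x / c" using c by simp
      also have "\<dots> \<le> 2 * real n / c" using xz c by (simp add: divide_right_mono)
      also have "\<dots> = M * norm y" using False e by (simp add: M_def c_def field_simps)
      finally show ?thesis .
    qed
    moreover have "norm (y - (1/c) *\<^sub>R z) \<le> norm y / 2"
    proof -
      have "y - (1/c) *\<^sub>R z = (1/c) *\<^sub>R (c *\<^sub>R y - z)"
        using c by (simp add: scaleR_diff_right)
      then have "norm (y - (1/c) *\<^sub>R z) = norm (c *\<^sub>R y - z) / c"
        using c by simp
      also have "\<dots> \<le> (e/4) / c"
        using xz c by (intro divide_right_mono) auto
      also have "\<dots> = norm y / 2" using False e by (simp add: c_def)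
      finally show ?thesis .
    qed
    ultimately show ?thesis by blast
  qed
  have halve': "\<forall>y. \<exists>p. y \<in> Range G \<longrightarrow> p \<in> G \<and> norm (fst p) \<le> M * norm y \<and> norm (y - snd p) \<le> norm y / 2"
    using halve by (metis fst_conv snd_conv)
  then obtain P where P: "\<And>y. y \<in> Range G \<Longrightarrow> P y \<in> G"
      "\<And>y. y \<in> Range G \<Longrightarrow> norm (fst (P y)) \<le> M * norm y"
      "\<And>y. y \<in> Range G \<Longrightarrow> norm (y - snd (P y)) \<le> norm y / 2"
    by metis
  show thesis
  proof (rule that[of "2 * M"])
    fix y assume y: "y \<in> Range G"
    \<comment> \<open>\<open>r i\<close> is the residual after \<open>i\<close> corrections. Each
      correction at least halves it, and the first \<open>m\<close> of them add up to
      \<open>y - r m\<close>.\<close>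
    define r where "r = rec_nat y (\<lambda>_ v. v - snd (P v))"
    have r0: "r 0 = y" and rS: "r (Suc i) = r i - snd (P (r i))" for i
      by (simp_all add: r_def)
    have rR: "r i \<in> Range G" for i
    proof (induction i)
      case (Suc i)
      have "snd (P (r i)) \<in> Range G"
        using P(1)[OF Suc] by (metis RangeI prod.collapse)
      then show ?case using Suc subspace_diff[OF subR] by (simp add: rS)
    qed (simp add: r0 y)
    have rn: "norm (r i) \<le> norm y * (1/2)^i" for i
    proof (induction i)
      case (Suc i)
      then show ?case using P(3)[OF rR[of i]] by (simp add: rS)
    qed (simp add: r0)
    define x where "x i = fst (P (r i))" for i
    have xn: "norm (x i) \<le> (M * norm y) * (1/2)^i" for i
    proof -
      have "norm (x i) \<le> M * norm (r i)" unfolding x_def by (rule P(2)[OF rR])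
      also have "\<dots> \<le> M * (norm y * (1/2)^i)" by (rule mult_left_mono[OF rn M0])
      finally show ?thesis by simp
    qed
    have gs: "(\<lambda>i. (M * norm y) * (1/2)^i) sums ((M * norm y) * 2)"
      using geometric_sums[of "1/2 :: real"] by (intro sums_mult) simp
    have sx: "summable (\<lambda>i. norm (x i))"
      using xn by (rule summable_norm_if_le_geometric)
    have "(\<Sum>i<m. snd (P (r i))) = y - r m" for m
      by (induction m) (simp_all add: r0 rS)
    moreover have "r \<longlonglongrightarrow> 0"
    proof (rule Lim_null_comparison)
      show "\<forall>\<^sub>F i in sequentially. norm (r i) \<le> norm y * (1/2)^i" using rn by simp
      show "(\<lambda>i. norm y * (1/2)^i) \<longlonglongrightarrow> 0"
        by (intro tendsto_mult_right_zero LIMSEQ_power_zero) simp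
    qed
    ultimately have lim: "(\<lambda>m. \<Sum>i<m. snd (P (r i))) \<longlonglongrightarrow> y"
      using tendsto_diff[OF tendsto_const[of y] \<open>r \<longlonglongrightarrow> 0\<close>] by simp
    have "(x i, snd (P (r i))) \<in> G" for i
      using P(1)[OF rR[of i]] by (simp add: x_def)
    then have "(suminf x, y) \<in> G"
      using sx lim by (rule closed_subspace_series[OF G])
    moreover have "norm (suminf x) \<le> 2 * M * norm y"
    proof -
      have "norm (suminf x) \<le> (\<Sum>i. norm (x i))" using sx by (rule summable_norm)
      also have "\<dots> \<le> (\<Sum>i. (M * norm y) * (1/2)^i)"
        by (rule suminf_le[OF xn sx sums_summable[OF gs]])
      also have "\<dots> = 2 * M * norm y" using gs by (simp add: sums_iff)
      finally show ?thesis .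
    qed
    ultimately show "\<exists>x. (x, y) \<in> G \<and> norm x \<le> 2 * M * norm y" by blast
  qed
qed

section \<open>Operators with a bounded factorisation\<close>

lemma subspace_relcomp:
  fixes R S :: "('a::real_vector \<times> 'a) set"
  assumes "subspace R" "subspace S"
  shows "subspace (R O S)"
proof (rule subspaceI)
  show "0 \<in> R O S"
    using assms[THEN subspace_0] by (auto simp: zero_prod_def)
next
  fix p q assume "p \<in> R O S" "q \<in> R O S"
  then show "p + q \<in> R O S"
    using assms[THEN subspace_add] by (auto simp: relcomp_unfold) (metis add_Pair)
next
  fix c p assume "p \<in> R O S"
  then show "c *\<^sub>R p \<in> R O S"
    using assms[THEN subspace_scale] by (auto simp: relcomp_unfold) (metis scaleR_Pair)
qed

lemma subspace_relpow:
  fixes R :: "('a::real_vector \<times> 'a) set"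
  assumes "subspace R"
  shows "subspace (R ^^ n)"
proof (induction n)
  case 0
  show ?case by (auto intro!: subspaceI simp: zero_prod_def)
next
  case (Suc n)
  then show ?case using assms by (simp add: subspace_relcomp)
qed

lemma subspace_Range:
  fixes R :: "('a::real_vector \<times> 'b::real_vector) set"
  assumes "subspace R"
  shows "subspace (Range R)"
  using linear_subspace_image[OF linear_snd assms] by (simp add: Range_snd)

lemma Range_relpow_antimono:
  fixes R :: "('a \<times> 'a) set"
  shows "n \<le> m \<Longrightarrow> Range (R ^^ m) \<subseteq> Range (R ^^ n)"
  using relpow_add[of "m - n" n R] by auto

lemma relpow_mult:
  fixes R :: "('a \<times> 'a) set"
  shows "R ^^ (m * n) = (R ^^ m) ^^ n"
proof (induction n)
  case (Suc n)
  then show ?case by (simp add: relpow_add relpow_commute)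
qed simp

lemma relpow_map:
  assumes "\<And>x y. (x, y) \<in> R \<Longrightarrow> (f x, f y) \<in> R" "(x, y) \<in> R ^^ n"
  shows "((f ^^ i) x, (f ^^ i) y) \<in> R ^^ n"
proof -
  have *: "(f x, f y) \<in> R ^^ n" if "(x, y) \<in> R ^^ n" for x y
    using that
  proof (induction n arbitrary: y)
    case (Suc n)
    then show ?case using assms(1) by (metis relpow_Suc_E relpow_Suc_I)
  qed simp
  show ?thesis
    by (induction i) (use assms(2) * in auto)
qed

lemma funpow_interchange:
  assumes "\<And>x. f (g x) = g (f x)"
  shows "(f ^^ n) ((g ^^ m) x) = (g ^^ m) ((f ^^ n) x)"
proof -
  have *: "f ((g ^^ m) x) = (g ^^ m) (f x)" for x
    by (induction m) (simp_all add: assms)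
  show ?thesis
    by (induction n) (simp_all add: *)
qed

lemma bounded_linear_funpow:
  fixes f :: "'a::real_normed_vector \<Rightarrow> 'a"
  assumes "bounded_linear f"
  shows "bounded_linear (f ^^ n)"
proof (induction n)
  case 0
  show ?case unfolding funpow.simps id_def by (rule bounded_linear_ident)
next
  case (Suc n)
  then show ?case
    using bounded_linear_compose[OF assms] by (simp add: comp_def)
qed

text \<open>Applying \<open>f\<close> to a whole chain of \<open>n\<close> links moves its start to
  the next power of \<open>f\<close>, and \<open>fg\<close> appends the missing link.\<close>

lemma relpow_factor:
  assumes map: "\<And>x y. (x, y) \<in> R \<Longrightarrow> (f x, f y) \<in> R"
    and fg: "\<And>x. (f x, g x) \<in> R"
  shows "((f ^^ n) x, (g ^^ n) x) \<in> R ^^ n"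
proof (induction n)
  case (Suc n)
  have "(f ((f ^^ n) x), f ((g ^^ n) x)) \<in> R ^^ n"
    using relpow_map[OF map Suc, where i = 1] by simp
  then show ?case
    using fg[of "(g ^^ n) x"] by (auto intro: relpow_Suc_I)
qed simp

text \<open>Single-valuedness forces \<open>f v = g u\<close> along every link
  \<open>(u, v)\<close>. This is how powers of an unbounded operator are traded for powers of
  bounded ones.\<close>

lemma relpow_factor_unique:
  assumes sv: "single_valued R"
    and map: "\<And>x y. (x, y) \<in> R \<Longrightarrow> (f x, f y) \<in> R"
    and fg: "\<And>x. (f x, g x) \<in> R"
    and xy: "(x, y) \<in> R ^^ n"
  shows "(f ^^ n) y = (g ^^ n) x"
proof -
  have step: "f v = g u" if "(u, v) \<in> R" for u v
    using sv map[OF that] fg[of u] by (auto dest: single_valuedD)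
  have comm: "f (g u) = g (f u)" for u
    using step[OF fg[of u]] .
  show ?thesis
    using xy
  proof (induction n arbitrary: y)
    case (Suc n)
    then obtain z where z: "(x, z) \<in> R ^^ n" "(z, y) \<in> R" by auto
    have "(f ^^ Suc n) y = (f ^^ n) (f y)" by (simp add: funpow_swap1)
    also have "\<dots> = g ((f ^^ n) z)"
      using funpow_interchange[of f g n 1 z, OF comm] step[OF z(2)] by simp
    finally show ?case using Suc.IH[OF z(1)] by simp
  qed simp
qed

section \<open>Everywhere defined operators and stable indices\<close>

lemma Range_total_op: "Range (total_op f) = range f"
  by (auto simp: total_op_def)

lemma total_op_relpow: "total_op f ^^ n = total_op (f ^^ n)"
  by (induction n) (auto simp: total_op_def)

lemma null_space_total_op: "null_space (total_op f) = {x. f x = 0}"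
  by (auto simp: total_op_def null_space_def)

lemma stable_indices_upward: "n \<in> stable_indices T \<Longrightarrow> n \<le> m \<Longrightarrow> m \<in> stable_indices T"
  unfolding stable_indices_def by (smt (verit) mem_Collect_eq order_trans)

lemma dis_in_stable_indices:
  assumes "stable_indices T \<noteq> {}"
  shows "\<exists>d \<in> stable_indices T. dis T = enat d"
proof -
  have "(LEAST x. x \<in> enat ` stable_indices T) \<in> enat ` stable_indices T"
    using assms LeastI[of "\<lambda>x. x \<in> enat ` stable_indices T"] by blast
  then show ?thesis
    using assms by (auto simp: dis_def Inf_enat_def)
qed

text \<open>\<open>E\<close> maps into the domain of \<open>T\<close>, \<open>C\<close> is the
  bounded operator \<open>T E\<close>, and \<open>TF\<close> encodes \<open>E - T F = I\<close>.
  \<open>C\<close> is kept apart from \<open>B\<close>, which is \<open>T ^^ k\<close> after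
  \<open>E\<close>, since \<open>k = 2\<close> also occurs. Graph membership includes the domain
  conditions.\<close>

locale factored_operator =
  fixes T :: "'a::complex_banach operator" and E F C B :: "'a \<Rightarrow> 'a" and k :: nat
  assumes subT: "subspace T" and svT: "single_valued T"
    and E: "bounded_linear E" and F: "bounded_linear F" and C: "bounded_linear C"
    and E_map: "(x, y) \<in> T \<Longrightarrow> (E x, E y) \<in> T"
    and F_map: "(x, y) \<in> T \<Longrightarrow> (F x, F y) \<in> T"
    and TF: "(F x, E x - x) \<in> T"
    and TE: "(E x, C x) \<in> T"
    and TB: "(E x, B x) \<in> T ^^ k" and k: "k > 0"
begin

text \<open>By \<open>TF\<close> this is also \<open>T F\<close>, so \<open>H ^^ n\<close> maps into
  the range of \<open>T ^^ n\<close>.\<close>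

definition H :: "'a \<Rightarrow> 'a" where "H x = E x - x"

lemma H: "bounded_linear H"
  unfolding H_def[abs_def] by (intro bounded_linear_sub E bounded_linear_ident)

lemma E_H: "E (H x) = H (E x)"
  by (simp add: H_def linear_diff[OF bounded_linear.linear[OF E]])

lemma E_C: "E (C x) = C (E x)"
  using relpow_factor_unique[OF svT E_map TE, where x = "E x" and y = "C x" and n = 1] TE by simp

text \<open>Limits \<open>a\<close> of \<open>x i\<close> and \<open>b\<close> of \<open>y i\<close>
  satisfy \<open>E a - a = F b\<close> and \<open>E b = C a\<close>, so \<open>(a, b)\<close> is the
  difference of the graph points \<open>(E a, C a)\<close> and
  \<open>(F b, E b - b)\<close>.\<close>

lemma closed_T: "closed T"
proof -
  have "(a, b) \<in> T" if f: "\<And>i. f i \<in> T" and lim: "f \<longlonglongrightarrow> (a, b)" for f a b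
  proof -
    define x where "x i = fst (f i)" for i
    define y where "y i = snd (f i)" for i
    have xy: "(x i, y i) \<in> T" for i using f by (simp add: x_def y_def)
    have lx: "x \<longlonglongrightarrow> a" and ly: "y \<longlonglongrightarrow> b"
      using tendsto_fst[OF lim] tendsto_snd[OF lim] by (simp_all add: x_def[abs_def] y_def[abs_def])
    have y: "E (y i) = C (x i)" for i
      using relpow_factor_unique[OF svT E_map TE, where x = "x i" and y = "y i" and n = 1] xy by simp
    have x: "E (x i) - x i = F (y i)" for i
      using single_valuedD[OF svT, of "F (x i)"] TF[of "x i"] F_map[OF xy]  by auto
    have "(\<lambda>i. E (x i) - x i) \<longlonglongrightarrow> E a - a"
      by (intro tendsto_intros bounded_linear.tendsto[OF E] lx)
    moreover have "(\<lambda>i. E (x i) - x i) \<longlonglongrightarrow> F b"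
      unfolding x by (intro bounded_linear.tendsto[OF F] ly)
    ultimately have "E a - a = F b"
      by (rule LIMSEQ_unique)
    then have a: "a = E a - F b"
      by (simp add: algebra_simps)
    have "(\<lambda>i. E (y i)) \<longlonglongrightarrow> E b"
      by (intro bounded_linear.tendsto[OF E] ly)
    moreover have "(\<lambda>i. E (y i)) \<longlonglongrightarrow> C a"
      unfolding y by (intro bounded_linear.tendsto[OF C] lx)
    ultimately have b: "E b = C a"
      by (rule LIMSEQ_unique)
    have "(E a - F b, C a - (E b - b)) \<in> T"
      using subspace_diff[OF subT TE[of a] TF[of b]] by simp
    then show ?thesis using a b by simp
  qed
  then show ?thesis
    unfolding closed_sequential_limits by (metis prod.collapse)
qed

text \<open>If \<open>E z\<close> is in \<open>V\<close>, the identity \<open>z = E z - H z\<close>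
  trades membership of \<open>z\<close> for that of \<open>H z\<close>, and so on up to
  \<open>H ^^ n\<close>, whose values lie in \<open>V\<close>. An abstract \<open>V\<close> serves
  both the ranges and the set in \<open>Range_relpow_eq\<close>.\<close>

lemma mem_if_E_mem:
  assumes V: "subspace V" and EV: "\<And>x. x \<in> V \<Longrightarrow> E x \<in> V"
    and Hn: "\<And>x. (H ^^ n) x \<in> V" and z: "(E ^^ j) z \<in> V"
  shows "z \<in> V"
proof -
  have HV: "(H ^^ i) x \<in> V" if "x \<in> V" for x i
    by (induction i) (use that EV subspace_diff[OF V] in \<open>auto simp: H_def\<close>)
  have one: "z \<in> V" if "E z \<in> V" for z
  proof -
    have "(H ^^ (n - i)) z \<in> V" if "i \<le> n" for i
      using that
    proof (induction i)
      case 0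
      show ?case using Hn by simp
    next
      case (Suc i)
      then have 1: "(H ^^ Suc (n - Suc i)) z \<in> V"
        by (simp add: Suc_diff_Suc del: funpow.simps)
      have "E ((H ^^ (n - Suc i)) z) \<in> V"
        using funpow_interchange[where f = E and g = H and n = 1, OF E_H] HV[OF \<open>E z \<in> V\<close>] by simp
      moreover have "(H ^^ (n - Suc i)) z = E ((H ^^ (n - Suc i)) z) - (H ^^ Suc (n - Suc i)) z"
        by (simp add: H_def)
      ultimately show ?case
        using subspace_diff[OF V _ 1] by metis
    qed
    from this[of n] show ?thesis by simp
  qed
  show ?thesis
    using z by (induction j) (auto intro: one)
qed

lemma TFn: "((F ^^ n) x, (H ^^ n) x) \<in> T ^^ n"
  by (rule relpow_factor[OF F_map]) (simp_all add: TF H_def)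

lemma TEn: "((E ^^ n) x, (C ^^ n) x) \<in> T ^^ n"
  by (rule relpow_factor[OF E_map TE])

lemma mem_Range_if_E_mem:
  assumes "(E ^^ j) x \<in> Range (T ^^ n)"
  shows "x \<in> Range (T ^^ n)"
proof (rule mem_if_E_mem[OF subspace_Range[OF subspace_relpow[OF subT]] _ _ assms])
  show "E y \<in> Range (T ^^ n)" if "y \<in> Range (T ^^ n)" for y
    using that relpow_map[where f = E and R = T and i = 1 and n = n, OF E_map] by auto
  show "(H ^^ n) y \<in> Range (T ^^ n)" for y
    using TFn by blast
qed

text \<open>Presents the range of an unbounded power as the range of a bounded map of two variables.
  The two terms are \<open>T ^^ n\<close> after \<open>E ^^ n\<close> and after
  \<open>F ^^ n\<close>; conversely \<open>(E ^^ n) x = (C ^^ n) y\<close> for \<open>(y, x)\<close>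
  in \<open>T ^^ n\<close>, and \<open>mem_if_E_mem\<close> removes \<open>E\<close>.\<close>

lemma Range_relpow_eq: "Range (T ^^ n) = {(C ^^ n) b + (H ^^ n) a | a b. True}" (is "_ = ?V")
proof
  have Cn: "linear (C ^^ n)" and Hn: "linear (H ^^ n)"
    by (intro bounded_linear.linear bounded_linear_funpow C H)+
  have V: "subspace ?V"
  proof (rule subspaceI)
    show "0 \<in> ?V"
      using linear_0[OF Cn] linear_0[OF Hn] by (auto intro!: exI[of _ 0])
    fix x y assume "x \<in> ?V" "y \<in> ?V"
    then obtain a b a' b' where "x = (C ^^ n) b + (H ^^ n) a" "y = (C ^^ n) b' + (H ^^ n) a'" by auto
    then have "x + y = (C ^^ n) (b + b') + (H ^^ n) (a + a')"
      by (simp add: linear_add[OF Cn] linear_add[OF Hn])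
    then show "x + y \<in> ?V" by blast
  next
    fix c x assume "x \<in> ?V"
    then obtain a b where "x = (C ^^ n) b + (H ^^ n) a" by auto
    then have "c *\<^sub>R x = (C ^^ n) (c *\<^sub>R b) + (H ^^ n) (c *\<^sub>R a)"
      by (simp add: linear_scale[OF Cn] linear_scale[OF Hn] scaleR_add_right)
    then show "c *\<^sub>R x \<in> ?V" by blast
  qed
  show "Range (T ^^ n) \<subseteq> ?V"
  proof
    fix x assume "x \<in> Range (T ^^ n)"
    then obtain y where "(y, x) \<in> T ^^ n" by auto
    then have x: "(E ^^ n) x = (C ^^ n) y"
      by (auto intro: relpow_factor_unique[OF svT E_map TE])
    show "x \<in> ?V"
    proof (rule mem_if_E_mem[OF V, where j = n and n = n])
      fix z assume "z \<in> ?V"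
      then obtain a b where "z = (C ^^ n) b + (H ^^ n) a" by auto
      then have "E z = (C ^^ n) (E b) + (H ^^ n) (E a)"
        using funpow_interchange[where f = E and g = C and n = 1, OF E_C] funpow_interchange[where f = E and g = H and n = 1, OF E_H]
        by (simp add: linear_add[OF bounded_linear.linear[OF E]])
      then show "E z \<in> ?V" by blast
    next
      have "(H ^^ n) z = (C ^^ n) 0 + (H ^^ n) z" for z
        by (simp add: linear_0[OF Cn])
      then show "(H ^^ n) z \<in> ?V" for z by blast
      have "(E ^^ n) x = (C ^^ n) y + (H ^^ n) 0"
        by (simp add: linear_0[OF Hn] x)
      then show "(E ^^ n) x \<in> ?V" by blast
    qed
  qed
  show "?V \<subseteq> Range (T ^^ n)"
    using subspace_add[OF subspace_Range[OF subspace_relpow[OF subT]]] TFn TEn by blast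
qed

text \<open>\<open>T\<close> maps \<open>M = R(T^n)\<close> onto the closed
  \<open>R(T^(n+1))\<close>, and its kernel in \<open>M\<close> is closed because \<open>st\<close>
  places it inside that range. Bounded preimages in \<open>M\<close> then make the graph of
  \<open>T\<close> restricted to \<open>M\<close> closed, and \<open>E\<close> carries limits of
  \<open>M\<close> into it.\<close>

lemma closed_Range_descend:
  assumes cl: "closed (Range (T ^^ Suc n))"
    and st: "Range (T ^^ n) \<inter> null_space T = Range (T ^^ Suc n) \<inter> null_space T"
  shows "closed (Range (T ^^ n))"
proof -
  define M where "M = Range (T ^^ n)"
  have subM: "subspace M"
    unfolding M_def by (intro subspace_Range subspace_relpow subT)
  have Cn: "bounded_linear (C ^^ n)" and Hn: "bounded_linear (H ^^ n)"
    by (intro bounded_linear_funpow C H)+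
  note lin = Cn[THEN bounded_linear.linear] Hn[THEN bounded_linear.linear]
  note cont = bounded_linear.continuous_on[OF Cn] bounded_linear.continuous_on[OF Hn]
  define Z where "Z = M \<inter> null_space T"
  have subZ: "subspace Z"
  proof -
    have "subspace (null_space T)"
      unfolding null_space_def using subspace_0[OF subT] subspace_add[OF subT] subspace_scale[OF subT]
      by (intro subspaceI) (fastforce simp: zero_prod_def)+
    then show ?thesis unfolding Z_def using subM by (simp add: subspace_inter)
  qed
  have closedZ: "closed Z"
  proof -
    have "null_space T = (\<lambda>x. (x, 0)) -` T" by (auto simp: null_space_def)
    moreover have "closed ((\<lambda>x. (x, 0)) -` T)"
      by (intro closed_vimage closed_T continuous_intros)
    ultimately show ?thesis unfolding Z_def M_def st using cl by auto
  qed
  \<comment> \<open>With the parameters \<open>a\<close> and \<open>b\<close> recorded,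
    \<open>u\<close> is placed in \<open>M\<close> by a continuous equation, so the relation is
    closed although \<open>M\<close> is not yet known to be.\<close>
  define G1 where "G1 = {((a, b, u), w) | a b u w. u = (C ^^ n) b + (H ^^ n) a \<and> (u, w) \<in> T}"
  have mem1: "((a, b, u), w) \<in> G1 \<longleftrightarrow> u = (C ^^ n) b + (H ^^ n) a \<and> (u, w) \<in> T" for a b u w
    by (auto simp: G1_def)
  have sub1: "subspace G1"
  proof (rule subspaceI)
    show "0 \<in> G1"
      using subspace_0[OF subT] by (simp add: zero_prod_def mem1 linear_0[OF lin(1)] linear_0[OF lin(2)])
    show "p + q \<in> G1" if pq: "p \<in> G1" "q \<in> G1" for p q
    proof -
      obtain a b u w a' b' u' w' where [simp]: "p = ((a, b, u), w)" "q = ((a', b', u'), w')"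
        by (metis prod.collapse)
      show ?thesis
        using pq subspace_add[OF subT, of "(u, w)" "(u', w')"]
        by (auto simp: mem1 linear_add[OF lin(1)] linear_add[OF lin(2)] algebra_simps)
    qed
    show "c *\<^sub>R p \<in> G1" if p: "p \<in> G1" for c p
    proof -
      obtain a b u w where [simp]: "p = ((a, b, u), w)"
        by (metis prod.collapse)
      show ?thesis
        using p subspace_scale[OF subT, of "(u, w)" c]
        by (auto simp: mem1 linear_scale[OF lin(1)] linear_scale[OF lin(2)] scaleR_add_right)
    qed
  qed
  have closed1: "closed G1"
  proof -
    have "G1 = {p. snd (snd (fst p)) = (C ^^ n) (fst (snd (fst p))) + (H ^^ n) (fst (fst p))}
        \<inter> (\<lambda>p. (snd (snd (fst p)), snd p)) -` T"
      by (auto simp: mem1)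
    then show ?thesis
      by (auto intro!: closed_Int closed_Collect_eq closed_vimage closed_T continuous_intros cont)
  qed
  have Range1: "Range G1 = Range (T ^^ Suc n)"
  proof -
    have "w \<in> Range G1 \<longleftrightarrow> (\<exists>u\<in>M. (u, w) \<in> T)" for w
      unfolding M_def Range_relpow_eq by (auto simp: G1_def)
    moreover have "w \<in> Range (T ^^ Suc n) \<longleftrightarrow> (\<exists>u\<in>M. (u, w) \<in> T)" for w
      by (auto simp: M_def)
    ultimately show ?thesis by blast
  qed
  obtain K where K: "\<And>w. w \<in> Range G1 \<Longrightarrow> \<exists>p. (p, w) \<in> G1 \<and> norm p \<le> K * norm w"
    using open_mapping_closed_relation[OF sub1 closed1] cl Range1 by metis
  \<comment> \<open>Its range is the graph of \<open>T\<close> restricted to \<open>M\<close>;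
    \<open>v\<close> absorbs the difference between a given preimage \<open>z\<close> of
    \<open>w\<close> and the preimage \<open>u\<close> with controlled norm.\<close>
  define G2 where "G2 = {((a, b, u, v), (z, w)) | a b u v z w.
      u = (C ^^ n) b + (H ^^ n) a \<and> (u, w) \<in> T \<and> v \<in> Z \<and> z = u + v}"
  have mem2: "((a, b, u, v), (z, w)) \<in> G2 \<longleftrightarrow>
      u = (C ^^ n) b + (H ^^ n) a \<and> (u, w) \<in> T \<and> v \<in> Z \<and> z = u + v" for a b u v z w
    by (auto simp: G2_def)
  have sub2: "subspace G2"
  proof (rule subspaceI)
    show "0 \<in> G2"
      using subspace_0[OF subT] subspace_0[OF subZ]
      by (simp add: zero_prod_def mem2 linear_0[OF lin(1)] linear_0[OF lin(2)])
    show "p + q \<in> G2" if pq: "p \<in> G2" "q \<in> G2" for p q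
    proof -
      obtain a b u v z w a' b' u' v' z' w' where [simp]: "p = ((a, b, u, v), z, w)" "q = ((a', b', u', v'), z', w')"
        by (metis prod.collapse)
      show ?thesis
        using pq subspace_add[OF subT, of "(u, w)" "(u', w')"] subspace_add[OF subZ, of v v']
        by (auto simp: mem2 linear_add[OF lin(1)] linear_add[OF lin(2)] algebra_simps)
    qed
    show "c *\<^sub>R p \<in> G2" if p: "p \<in> G2" for c p
    proof -
      obtain a b u v z w where [simp]: "p = ((a, b, u, v), z, w)"
        by (metis prod.collapse)
      show ?thesis
        using p subspace_scale[OF subT, of "(u, w)" c] subspace_scale[OF subZ, of v c]
        by (auto simp: mem2 linear_scale[OF lin(1)] linear_scale[OF lin(2)] scaleR_add_right)
    qed
  qed
  have closed2: "closed G2"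
  proof -
    have "G2 = {p. fst (snd (snd (fst p))) = (C ^^ n) (fst (snd (fst p))) + (H ^^ n) (fst (fst p))}
        \<inter> (\<lambda>p. (fst (snd (snd (fst p))), snd (snd p))) -` T
        \<inter> (\<lambda>p. snd (snd (snd (fst p)))) -` Z
        \<inter> {p. fst (snd p) = fst (snd (snd (fst p))) + snd (snd (snd (fst p)))}"
      by (auto simp: mem2)
    then show ?thesis
      by (auto intro!: closed_Int closed_Collect_eq closed_vimage closed_T closedZ continuous_intros cont)
  qed
  have Range2: "q \<in> Range G2 \<longleftrightarrow> q \<in> T \<and> fst q \<in> M" for q
  proof
    assume "q \<in> Range G2"
    then obtain a b u v where "((a, b, u, v), (fst q, snd q)) \<in> G2" by auto
    then have q: "u = (C ^^ n) b + (H ^^ n) a" "(u, snd q) \<in> T" "v \<in> Z" "fst q = u + v"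
      unfolding mem2 by blast+
    have "u \<in> M" unfolding M_def Range_relpow_eq using q(1) by blast
    then have "fst q \<in> M" using q subspace_add[OF subM] by (simp add: Z_def)
    moreover have "(u + v, snd q + 0) \<in> T"
      using subspace_add[OF subT q(2), of "(v, 0)"] q(3) by (simp add: Z_def null_space_def)
    ultimately show "q \<in> T \<and> fst q \<in> M" using q(4) by (metis add.right_neutral prod.collapse)
  next
    assume q: "q \<in> T \<and> fst q \<in> M"
    then obtain a b where "fst q = (C ^^ n) b + (H ^^ n) a"
      unfolding M_def Range_relpow_eq by blast
    moreover have "(fst q, snd q) \<in> T" using q by simp
    ultimately have "((a, b, fst q, 0), (fst q, snd q)) \<in> G2"
      using subspace_0[OF subZ] unfolding mem2 by simp
    then show "q \<in> Range G2" by auto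
  qed
  have "closed (Range G2)"
  \<comment> \<open>The triple \<open>(a, b, u)\<close> contributes
    \<open>\<bar>K\<bar> * norm q\<close>, and \<open>v = z - u\<close> at most
    \<open>norm q\<close> plus the same amount again.\<close>
  proof (rule closed_Range_if_bounded_preimages[OF sub2 closed2, where K = "2 * \<bar>K\<bar> + 1"])
    fix q assume q: "q \<in> Range G2"
    obtain z w where zw: "q = (z, w)" "(z, w) \<in> T" "z \<in> M"
      using q unfolding Range2 by (metis prod.collapse)
    have "w \<in> Range G1" using zw unfolding Range1 M_def by auto
    then obtain a b u where abu: "((a, b, u), w) \<in> G1" "norm (a, b, u) \<le> K * norm w"
      using K by (metis prod_cases3)
    have nabu: "norm (a, b, u) \<le> \<bar>K\<bar> * norm q"
    proof -
      have "norm (a, b, u) \<le> \<bar>K\<bar> * norm w" using abu(2)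
        by (meson abs_ge_self mult_right_mono norm_ge_zero order_trans)
      also have "\<dots> \<le> \<bar>K\<bar> * norm q"
        using norm_snd_le[of w z] zw(1) by (intro mult_left_mono) auto
      finally show ?thesis .
    qed
    have u: "u \<in> M" "(u, w) \<in> T" "u = (C ^^ n) b + (H ^^ n) a"
      using abu(1) unfolding M_def Range_relpow_eq mem1 by auto
    define v where "v = z - u"
    have "v \<in> Z"
      using subspace_diff[OF subM zw(3) u(1)] subspace_diff[OF subT zw(2) u(2)]
      by (simp add: Z_def v_def null_space_def)
    then have "((a, b, u, v), q) \<in> G2"
      using u by (simp add: zw(1) mem2 v_def)
    moreover have "norm (a, b, u, v) \<le> (2 * \<bar>K\<bar> + 1) * norm q"
    proof -
      have "norm (a, b, u, v) \<le> norm (a, b, u, 0::'a) + norm (0::'a, 0::'a, 0::'a, v)"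
        using norm_triangle_ineq[of "(a, b, u, 0)" "(0, 0, 0, v)"] by simp
      also have "\<dots> = norm (a, b, u) + norm v"
        by (simp add: norm_prod_def)
      also have "norm v \<le> norm z + norm u"
        unfolding v_def by (rule norm_triangle_ineq4)
      also have "norm z \<le> norm q"
        using norm_fst_le[of z w] zw(1) by simp
      also have "norm u \<le> norm (a, b, u)"
        using norm_snd_le[of u b] norm_snd_le[of "(b, u)" a] by linarith
      finally show ?thesis
        using nabu by (simp add: algebra_simps)
    qed
    ultimately show "\<exists>p. (p, q) \<in> G2 \<and> norm p \<le> (2 * \<bar>K\<bar> + 1) * norm q" by blast
  qed
  \<comment> \<open>The \<open>f i\<close> may lie outside the domain of \<open>T\<close>, but the
    points \<open>(E (f i), C (f i))\<close> belong to the restricted graph and converge.\<close>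
  have "x \<in> M" if x: "\<And>i. f i \<in> M" "f \<longlonglongrightarrow> x" for f x
  proof -
    have EM: "E y \<in> M" if "y \<in> M" for y
      using that relpow_map[where f = E and R = T and i = 1 and n = n, OF E_map]
      unfolding M_def by auto
    have "(E (f i), C (f i)) \<in> Range G2" for i
      using Range2 TE EM[OF x(1)] by simp
    moreover have "(\<lambda>i. (E (f i), C (f i))) \<longlonglongrightarrow> (E x, C x)"
      by (intro tendsto_intros bounded_linear.tendsto[OF E] bounded_linear.tendsto[OF C] x(2))
    ultimately have "(E x, C x) \<in> Range G2"
      using \<open>closed (Range G2)\<close> by (meson closed_sequentially)
    then have "(E ^^ 1) x \<in> M" using Range2 by simp
    then show ?thesis
      unfolding M_def by (rule mem_Range_if_E_mem)
  qed
  then show ?thesis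
    unfolding M_def[symmetric] closed_sequential_limits by blast
qed

text \<open>\<open>C ^^ n\<close> kills \<open>N(T^n)\<close> and sends \<open>R(T)\<close> into
  \<open>R(T^(n+1))\<close>. Conversely, if \<open>T^(n+1) w = C^n x\<close>, then
  \<open>E^n x - T w\<close> is in \<open>N(T^n)\<close>, while \<open>x - E^n x\<close> is in
  \<open>R(T)\<close> because \<open>E - I = T F\<close>.\<close>

lemma closed_Range_plus_null_space:
  assumes cl: "closed (Range (T ^^ Suc n))"
  shows "closed {u + v | u v. u \<in> Range T \<and> v \<in> null_space (T ^^ n)}" (is "closed ?V")
proof -
  have Cn: "bounded_linear (C ^^ n)" by (intro bounded_linear_funpow C)
  have VC: "(C ^^ n) x \<in> Range (T ^^ Suc n)" if "x \<in> ?V" for x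
  proof -
    obtain u v w where uv: "x = u + v" "(w, u) \<in> T" "(v, 0) \<in> T ^^ n"
      using \<open>x \<in> ?V\<close> by (auto simp: null_space_def)
    have "(C ^^ n) v = (E ^^ n) 0"
      using relpow_factor_unique[OF svT E_map TE uv(3)] by simp
    then have "(C ^^ n) x = (C ^^ n) u"
      using uv(1) by (simp add: linear_add[OF bounded_linear.linear[OF Cn]]
          linear_0[OF bounded_linear.linear[OF bounded_linear_funpow[OF E]]])
    moreover have "((E ^^ n) w, (E ^^ n) u) \<in> T"
      using relpow_map[where f = E and R = T and i = n and n = 1, OF E_map] uv(2) by simp
    then have "((E ^^ n) w, (C ^^ n) u) \<in> T ^^ Suc n"
      using TEn by (rule relpow_Suc_I2)
    ultimately show ?thesis by auto
  qed
  have CV: "x \<in> ?V" if x: "(C ^^ n) x \<in> Range (T ^^ Suc n)" for x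
  proof -
    obtain w where "(w, (C ^^ n) x) \<in> T ^^ Suc n" using x by auto
    then obtain w' where w': "(w, w') \<in> T" "(w', (C ^^ n) x) \<in> T ^^ n"
      by (meson relpow_Suc_D2)
    have "((E ^^ n) x - w', 0) \<in> T ^^ n"
      using subspace_diff[OF subspace_relpow[OF subT] TEn[of n x] w'(2)] by simp
    moreover have "x - (E ^^ n) x \<in> Range T"
    proof (induction n)
      case 0
      show ?case using subspace_0[OF subspace_Range[OF subT]] by simp
    next
      case (Suc n)
      have "E ((E ^^ n) x) - (E ^^ n) x \<in> Range T" using TF by blast
      from subspace_diff[OF subspace_Range[OF subT] Suc this] show ?case by simp
    qed
    then have "x - (E ^^ n) x + w' \<in> Range T"
      using w'(1) subspace_add[OF subspace_Range[OF subT]] by blast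
    moreover have "x = (x - (E ^^ n) x + w') + ((E ^^ n) x - w')" by simp
    ultimately show ?thesis unfolding null_space_def by blast
  qed
  have "?V = (C ^^ n) -` Range (T ^^ Suc n)"
    using VC CV by blast
  then show ?thesis
    using cl closed_vimage bounded_linear.continuous_on[OF Cn continuous_on_id]
    by (metis (no_types, lifting))
qed

text \<open>\<open>T\<close> sends \<open>F x\<close> both to \<open>F 0 = 0\<close> and to
  \<open>E x - x\<close>.\<close>

lemma E_eq_on_null_space:
  assumes "x \<in> null_space T"
  shows "(E ^^ j) x = x"
proof -
  have "F 0 = 0" by (rule linear_0[OF bounded_linear.linear[OF F]])
  then have "(F x, 0) \<in> T" using F_map[of x 0] assms by (simp add: null_space_def)
  then have "E x = x" using single_valuedD[OF svT] TF[of x] by fastforce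
  then show ?thesis by (induction j) simp_all
qed

lemma B_factor: "((E ^^ j) x, (B ^^ j) x) \<in> T ^^ (k * j)"
  unfolding relpow_mult
  by (rule relpow_factor[OF _ TB]) (use relpow_map[where i = 1, OF E_map] in simp)

lemma B_factor_unique: "(x, y) \<in> T ^^ (k * j) \<Longrightarrow> (E ^^ j) y = (B ^^ j) x"
  unfolding relpow_mult
  by (rule relpow_factor_unique[OF single_valued_relpow[OF svT] _ TB])
    (use relpow_map[where i = 1, OF E_map] in simp_all)

text \<open>A vector \<open>x\<close> lies in the range of \<open>T ^^ (k * j)\<close> exactly when
  \<open>(E ^^ j) x\<close> lies in that of \<open>B ^^ j\<close>, which is a closed
  condition.\<close>

lemma closed_Range_mult:
  assumes "closed (range (B ^^ j))"
  shows "closed (Range (T ^^ (k * j)))"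
proof -
  have "x \<in> Range (T ^^ (k * j))" if f: "\<And>i. f i \<in> Range (T ^^ (k * j))" "f \<longlonglongrightarrow> x" for f x
  proof -
    have "(E ^^ j) (f i) \<in> range (B ^^ j)" for i
      using f(1)[of i] B_factor_unique by auto
    moreover have "(\<lambda>i. (E ^^ j) (f i)) \<longlonglongrightarrow> (E ^^ j) x"
      by (intro bounded_linear.tendsto[OF bounded_linear_funpow[OF E]] f(2))
    ultimately have "(E ^^ j) x \<in> range (B ^^ j)"
      using assms by (meson closed_sequentially)
    then have "(E ^^ j) x \<in> Range (T ^^ (k * j))"
      by (metis B_factor RangeI rangeE)
    then show ?thesis by (rule mem_Range_if_E_mem)
  qed
  then show ?thesis
    unfolding closed_sequential_limits by blast
qed

text \<open>On \<open>N(T)\<close> the map \<open>E\<close> is the identity and \<open>B\<close>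
  vanishes, so the ranges of \<open>T ^^ (k * d)\<close> and \<open>B ^^ d\<close> meet it in the
  same vectors; stability of \<open>B\<close> then leads to \<open>B ^^ m\<close>, hence into the
  range of \<open>T ^^ (k * m)\<close>.\<close>

lemma stable_index_mult:
  assumes d: "d \<in> stable_indices (total_op B)"
  shows "k * d \<in> stable_indices T"
proof -
  have "Range (T ^^ (k * d)) \<inter> null_space T \<subseteq> Range (T ^^ m)" if m: "k * d \<le> m" for m
  proof
    fix x assume x: "x \<in> Range (T ^^ (k * d)) \<inter> null_space T"
    then have "x \<in> range (B ^^ d)"
      using B_factor_unique E_eq_on_null_space by (metis IntE RangeE rangeI)
    moreover have "B x = 0"
    proof -
      have x0: "(x, 0) \<in> T" using x by (simp add: null_space_def)
      \<comment> \<open>Positivity of \<open>k\<close> enters here: the chain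
        \<open>x, 0, ..., 0\<close> has at least one link.\<close>
      have "(x, 0) \<in> T ^^ k"
        using k
      proof (induction k rule: nat_induct_non_zero)
        case (Suc k)
        then show ?case using subspace_0[OF subT] by (auto simp: zero_prod_def)
      qed (simp add: x0)
      moreover have "(x, B x) \<in> T ^^ k"
        using TB[of x] E_eq_on_null_space[of x 1] x by simp
      ultimately show ?thesis
        using single_valuedD[OF single_valued_relpow[OF svT]] by blast
    qed
    moreover have "d \<le> m" using m k by (metis dual_order.trans mult_le_mono1 nat_mult_1 Suc_leI One_nat_def)
    then have "range (B ^^ d) \<inter> {x. B x = 0} = range (B ^^ m) \<inter> {x. B x = 0}"
      using d by (auto simp: stable_indices_def total_op_relpow Range_total_op null_space_total_op)
    ultimately have "x \<in> range (B ^^ m)" by blast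
    then obtain y where "x = (B ^^ m) y" by auto
    then have "x \<in> Range (T ^^ (k * m))"
      using B_factor[of m y] by auto
    then show "x \<in> Range (T ^^ m)"
      using Range_relpow_antimono[of m "k * m" T] k by auto
  qed
  moreover have "Range (T ^^ m) \<subseteq> Range (T ^^ (k * d))" if "k * d \<le> m" for m
    by (rule Range_relpow_antimono[OF that])
  ultimately show ?thesis
    unfolding stable_indices_def by blast
qed

text \<open>The degree \<open>d'\<close> of \<open>T\<close> may be smaller than
  \<open>k * d\<close>. Closed ranges are first obtained at multiples of \<open>k\<close> and then
  carried down to every \<open>n \<ge> d'\<close>, where stability permits
  \<open>closed_Range_descend\<close>.\<close>

theorem quasi_Fredholm_if_factor:
  assumes d: "d \<in> stable_indices (total_op B)"
    and cl: "\<And>n. n \<ge> d \<Longrightarrow> closed (range (B ^^ n))"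
  shows "quasi_Fredholm T"
proof -
  obtain d' where d': "d' \<in> stable_indices T" "dis T = enat d'"
    using dis_in_stable_indices stable_index_mult[OF d] by (metis empty_iff)
  have descend: "closed (Range (T ^^ n))" if "closed (Range (T ^^ (n + i)))" "n \<ge> d'" for n i
    using that
  proof (induction i arbitrary: n)
    case (Suc i)
    have "closed (Range (T ^^ Suc n))" using Suc by (metis Suc.IH add_Suc_shift le_SucI)
    moreover have "Range (T ^^ n) \<inter> null_space T = Range (T ^^ Suc n) \<inter> null_space T"
      using stable_indices_upward[OF d'(1) Suc.prems(2)] by (auto simp: stable_indices_def simp del: relpow.simps)
    ultimately show ?case by (rule closed_Range_descend)
  qed simp
  have R: "closed (Range (T ^^ n))" if "n \<ge> d'" for n
  proof (rule descend[OF _ that])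
    \<comment> \<open>A multiple of \<open>k\<close> not below \<open>n\<close>, whose cofactor
      \<open>n + d\<close> is at least \<open>d\<close> as \<open>cl\<close> requires.\<close>
    have "n \<le> k * (n + d)" using k by (cases k) auto
    then show "closed (Range (T ^^ (n + (k * (n + d) - n))))"
      using closed_Range_mult[OF cl[of "n + d"]] by simp
  qed
  show ?thesis
    unfolding quasi_Fredholm_def
    using d'(2) R closed_Range_plus_null_space by (meson le_SucI)
qed

end

section \<open>Strongly continuous families and exponential convolutions\<close>

lemma bounded_bilinear_scaleC:
  "bounded_bilinear (scaleC :: complex \<Rightarrow> 'a::complex_banach \<Rightarrow> 'a)"
proof
  fix a b :: complex and x y :: 'a and r :: real
  show "(a + b) *\<^sub>C x = a *\<^sub>C x + b *\<^sub>C x" by (rule scaleC_add_left)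
  show "a *\<^sub>C (x + y) = a *\<^sub>C x + a *\<^sub>C y" by (rule scaleC_add_right)
  show "(r *\<^sub>R a) *\<^sub>C x = r *\<^sub>R a *\<^sub>C x"
    by (simp add: scaleC_scaleC scaleR_conv_of_real flip: scaleC_of_real)
  show "a *\<^sub>C r *\<^sub>R x = r *\<^sub>R a *\<^sub>C x"
    by (simp add: scaleC_scaleC mult.commute flip: scaleC_of_real)
  show "\<exists>K. \<forall>a (x::'a). norm (a *\<^sub>C x) \<le> norm a * norm x * K"
    by (intro exI[of _ 1]) (simp add: norm_scaleC)
qed

lemmas continuous_on_scaleC [continuous_intros] =
  bounded_bilinear.continuous_on[OF bounded_bilinear_scaleC]
lemmas scaleC_diff_right = bounded_bilinear.diff_right[OF bounded_bilinear_scaleC]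
lemmas scaleC_minus_left = bounded_bilinear.minus_left[OF bounded_bilinear_scaleC]
lemmas scaleC_zero_right = bounded_bilinear.zero_right[OF bounded_bilinear_scaleC]
lemmas scaleC_zero_left = bounded_bilinear.zero_left[OF bounded_bilinear_scaleC]
lemmas bounded_linear_scaleC_right = bounded_bilinear.bounded_linear_right[OF bounded_bilinear_scaleC]
lemmas bounded_linear_scaleC_left = bounded_bilinear.bounded_linear_left[OF bounded_bilinear_scaleC]

lemma scaleC_one: "1 *\<^sub>C x = x"
  using scaleC_of_real[of 1 x] by simp

section \<open>Integrals and derivatives on the nonnegative half-line\<close>

lemma integral_bounded_linear:
  fixes f :: "real \<Rightarrow> 'a::banach" and h :: "'a \<Rightarrow> 'b::banach"
  assumes "bounded_linear h" "continuous_on {a..b::real} f"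
  shows "integral {a..b} (\<lambda>s. h (f s)) = h (integral {a..b} f)"
  using integral_linear[OF integrable_continuous_real[OF assms(2)] assms(1)] by (simp add: comp_def)

lemma continuous_on_nonneg_imp_Icc:
  fixes f :: "real \<Rightarrow> 'a::topological_space"
  assumes "continuous_on {0..} f" "0 \<le> a"
  shows "continuous_on {a..b} f"
  using assms(1) by (rule continuous_on_subset) (use assms(2) in auto)

lemma at_within_nonneg_eq:
  fixes t :: real
  assumes "t \<ge> 0"
  shows "at t within {0..} = at t within {0..t + 1}"
  by (rule at_within_nhd[of _ "{..<t + 1}"]) (use assms in auto)

lemma indefinite_integral_has_vector_derivative:
  fixes f :: "real \<Rightarrow> 'a::banach"
  assumes "continuous_on {0..} f" "t \<ge> 0"
  shows "((\<lambda>r. integral {0..r} f) has_vector_derivative f t) (at t within {0..})"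
  unfolding at_within_nonneg_eq[OF assms(2)]
  using assms by (intro integral_has_vector_derivative continuous_on_nonneg_imp_Icc) auto

lemma continuous_on_indefinite_integral:
  fixes f :: "real \<Rightarrow> 'a::banach"
  assumes "continuous_on {0..} f"
  shows "continuous_on {0..} (\<lambda>r. integral {0..r} f)"
  using indefinite_integral_has_vector_derivative[OF assms]
  by (meson atLeast_iff continuous_on_eq_continuous_within has_vector_derivative_continuous)

lemma integral_FTC:
  fixes f :: "real \<Rightarrow> 'a::banach"
  assumes "\<And>s. s \<ge> 0 \<Longrightarrow> (f has_vector_derivative f' s) (at s within {0..})" "t \<ge> 0"
  shows "integral {0..t} f' = f t - f 0"
proof (rule integral_unique, rule fundamental_theorem_of_calculus[OF assms(2)])
  show "(f has_vector_derivative f' s) (at s within {0..t})" if "s \<in> {0..t}" for s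
    by (rule has_vector_derivative_within_subset[OF assms(1)]) (use that in auto)
qed

lemma integral_shift_nonneg:
  fixes f :: "real \<Rightarrow> 'a::banach"
  assumes "continuous_on {0..} f" "a \<ge> 0" "r \<ge> 0"
  shows "integral {0..r} (\<lambda>s. f (s + a)) = integral {0..r + a} f - integral {0..a} f"
proof -
  have "integral {0..r} (\<lambda>s. f (s + a)) = integral {a..r + a} f"
    using integral_shift_real_ivl[of a a "r + a" f] by simp
  moreover have "integral {0..a} f + integral {a..r + a} f = integral {0..r + a} f"
    using assms by (intro Henstock_Kurzweil_Integration.integral_combine integrable_continuous_real continuous_on_nonneg_imp_Icc) auto
  ultimately show ?thesis by (simp add: algebra_simps)
qed

lemma continuous_on_shift_nonneg:
  fixes f :: "real \<Rightarrow> 'a::topological_space"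
  assumes "continuous_on {0..} f" "a \<ge> 0"
  shows "continuous_on {0..} (\<lambda>s. f (s + a))"
  by (rule continuous_on_compose2[OF assms(1)]) (use assms(2) in \<open>auto intro!: continuous_intros\<close>)

instance bcontfun :: (metric_space, banach) banach ..

text \<open>A uniform boundedness principle drawn from the open mapping theorem: the relation
  between bounded continuous functions that agree with an orbit on \<open>{a..b}\<close> and the
  vector generating the orbit is closed with full range, so some such function has norm at most
  \<open>K * norm x\<close>.\<close>

lemma uniform_bound_on_interval:
  fixes W :: "real \<Rightarrow> 'a::banach \<Rightarrow> 'a"
  assumes lin: "\<And>s. s \<in> {a..b} \<Longrightarrow> bounded_linear (W s)"
    and cont: "\<And>x. continuous_on {a..b} (\<lambda>s. W s x)"
  obtains K where "K \<ge> 0" "\<And>s x. s \<in> {a..b} \<Longrightarrow> norm (W s x) \<le> K * norm x"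
proof -
  define G :: "((real \<Rightarrow>\<^sub>C 'a) \<times> 'a) set"
    where "G = (\<Inter>s\<in>{a..b}. {p. apply_bcontfun (fst p) s = W s (snd p)})"
  have "subspace {p. apply_bcontfun (fst p) s = W s (snd p)}" if "s \<in> {a..b}" for s
    using linear_0 linear_add linear_scale bounded_linear.linear[OF lin[OF that]]
    by (intro subspaceI) (auto simp: plus_bcontfun.rep_eq zero_bcontfun.rep_eq scaleR_bcontfun.rep_eq
        linear_0 linear_add linear_scale)
  then have sub: "subspace G"
    unfolding G_def by (intro subspace_Int) auto
  have ev: "bounded_linear (\<lambda>g :: real \<Rightarrow>\<^sub>C 'a. apply_bcontfun g s)" for s
    by (rule bounded_linear_intro[where K = 1])
      (auto simp: plus_bcontfun.rep_eq scaleR_bcontfun.rep_eq norm_bounded)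
  have cl: "closed G"
    unfolding G_def
    by (intro closed_INT ballI closed_Collect_eq bounded_linear.continuous_on[OF ev]
        bounded_linear.continuous_on[OF lin] continuous_on_fst continuous_on_snd continuous_on_id)
  have R: "x \<in> Range G" for x
  proof -
    have "continuous_on (cbox a b) (\<lambda>s. W s x)" using cont by simp
    then obtain g :: "real \<Rightarrow>\<^sub>C 'a" where g: "\<forall>s\<in>cbox a b. apply_bcontfun g s = W s x"
      by (rule continuous_on_cbox_bcontfunE) blast
    then have "(g, x) \<in> G" by (auto simp: G_def)
    then show ?thesis by auto
  qed
  then have "closed (Range G)"
    by (metis UNIV_eq_I closed_UNIV)
  then obtain K where K: "\<And>x. x \<in> Range G \<Longrightarrow> \<exists>g. (g, x) \<in> G \<and> norm g \<le> K * norm x"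
    using open_mapping_closed_relation[OF sub cl] by blast
  show thesis
  proof (rule that[of "\<bar>K\<bar>"])
    fix s x assume s: "s \<in> {a..b}"
    obtain g where g: "(g, x) \<in> G" "norm g \<le> K * norm x" using K[OF R] by auto
    have "W s x = apply_bcontfun g s" using g(1) s by (auto simp: G_def)
    then have "norm (W s x) \<le> norm g" by (simp add: norm_bounded)
    also have "\<dots> \<le> \<bar>K\<bar> * norm x"
      using g(2) by (meson abs_ge_self mult_right_mono norm_ge_zero order_trans)
    finally show "norm (W s x) \<le> \<bar>K\<bar> * norm x" .
  qed simp
qed

section \<open>Strongly continuous families of bounded operators\<close>

definition strong_family :: "(real \<Rightarrow> 'a::complex_banach \<Rightarrow> 'a) \<Rightarrow> bool" where
  "strong_family W \<longleftrightarrow>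
     (\<forall>t\<ge>0. bounded_clinear (W t)) \<and> (\<forall>x. continuous_on {0..} (\<lambda>t. W t x))"

lemma strong_familyD:
  assumes "strong_family W"
  shows strong_family_bounded_linear: "t \<ge> 0 \<Longrightarrow> bounded_linear (W t)"
    and strong_family_scaleC: "t \<ge> 0 \<Longrightarrow> W t (c *\<^sub>C x) = c *\<^sub>C W t x"
    and strong_family_continuous: "continuous_on {0..} (\<lambda>t. W t x)"
  using assms by (auto simp: strong_family_def bounded_clinear_def)

lemma strong_family_mult:
  assumes W: "strong_family W" and g: "continuous_on {0..} g"
  shows "strong_family (\<lambda>t x. g t *\<^sub>C W t x)"
  unfolding strong_family_def bounded_clinear_def
  using strong_familyD[OF W]
  by (auto intro!: continuous_intros g bounded_linear_compose[OF bounded_linear_scaleC_right]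
      simp: scaleC_scaleC mult.commute)

text \<open>Boundedness is the point: a bound uniform in \<open>s\<close> on \<open>{0..t}\<close>
  integrates to \<open>K * t\<close>.\<close>

lemma strong_family_integral:
  assumes W: "strong_family W"
  shows "strong_family (\<lambda>t x. integral {0..t} (\<lambda>s. W s x))"
proof -
  note D = strong_familyD[OF W]
  note int = integrable_continuous_real[OF continuous_on_nonneg_imp_Icc[OF D(3)]]
  have "bounded_linear (\<lambda>x. integral {0..t} (\<lambda>s. W s x))" if t: "t \<ge> 0" for t
  proof -
    obtain K where K: "K \<ge> 0" "\<And>s x. s \<in> {0..t} \<Longrightarrow> norm (W s x) \<le> K * norm x"
      by (rule uniform_bound_on_interval[of 0 t W])
        (simp_all add: D continuous_on_nonneg_imp_Icc[OF D(3)])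
    show ?thesis
    proof (rule bounded_linear_intro[where K = "K * t"])
      fix x y
      have "integral {0..t} (\<lambda>s. W s (x + y)) = integral {0..t} (\<lambda>s. W s x + W s y)"
        by (intro integral_cong) (simp add: linear_add bounded_linear.linear D)
      then show "integral {0..t} (\<lambda>s. W s (x + y))
          = integral {0..t} (\<lambda>s. W s x) + integral {0..t} (\<lambda>s. W s y)"
        by (simp add: integral_add int)
    next
      fix c x
      have "integral {0..t} (\<lambda>s. W s (c *\<^sub>R x)) = integral {0..t} (\<lambda>s. c *\<^sub>R W s x)"
        by (intro integral_cong) (simp add: linear_scale bounded_linear.linear D)
      then show "integral {0..t} (\<lambda>s. W s (c *\<^sub>R x)) = c *\<^sub>R integral {0..t} (\<lambda>s. W s x)"
        by simp
    next
      fix x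
      have "norm (integral {0..t} (\<lambda>s. W s x)) \<le> (K * norm x) * (t - 0)"
        by (rule integral_bound[OF t continuous_on_nonneg_imp_Icc[OF D(3)]]) (use K in auto)
      then show "norm (integral {0..t} (\<lambda>s. W s x)) \<le> norm x * (K * t)"
        by (simp add: mult_ac)
    qed
  qed
  moreover have "integral {0..t} (\<lambda>s. W s (c *\<^sub>C x)) = c *\<^sub>C integral {0..t} (\<lambda>s. W s x)"
    if "t \<ge> 0" for t c x
  proof -
    have "integral {0..t} (\<lambda>s. W s (c *\<^sub>C x)) = integral {0..t} (\<lambda>s. c *\<^sub>C W s x)"
      by (intro integral_cong) (simp add: D)
    then show ?thesis
      by (simp add: integral_bounded_linear[OF bounded_linear_scaleC_right] continuous_on_nonneg_imp_Icc D(3))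
  qed
  ultimately show ?thesis
    unfolding strong_family_def bounded_clinear_def
    by (auto intro: continuous_on_indefinite_integral D(3))
qed

section \<open>Convolution with an exponential function\<close>

lemma continuous_on_exp: "continuous_on A (\<lambda>s::real. exp (c * complex_of_real s))"
  by (intro continuous_intros)

text \<open>\<open>exp_conv l f t\<close> is \<open>\<integral>\<^sub>0\<^sup>t e\<^sup>l\<^sup>(\<^sup>t\<^sup>-\<^sup>s\<^sup>) f(s) ds\<close>, the solution of \<open>u' = l u + f\<close>, \<open>u(0) = 0\<close>.\<close>

definition exp_conv :: "complex \<Rightarrow> (real \<Rightarrow> 'a::complex_banach) \<Rightarrow> real \<Rightarrow> 'a" where
  "exp_conv l f t = exp (l * of_real t) *\<^sub>C integral {0..t} (\<lambda>s. exp (- l * of_real s) *\<^sub>C f s)"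

context
  fixes l :: complex
begin

lemma continuous_on_exp_conv:
  assumes "continuous_on {0..} f"
  shows "continuous_on {0..} (exp_conv l f)"
  unfolding exp_conv_def[abs_def]
  by (intro continuous_intros continuous_on_exp continuous_on_indefinite_integral assms)

lemma strong_family_exp_conv:
  assumes "strong_family W"
  shows "strong_family (\<lambda>t x. exp_conv l (\<lambda>s. W s x) t)"
  unfolding exp_conv_def
  by (intro strong_family_mult strong_family_integral assms continuous_on_exp)

lemma exp_conv_cong:
  assumes "\<And>s. s \<ge> 0 \<Longrightarrow> f s = g s"
  shows "exp_conv l f t = exp_conv l g t"
  unfolding exp_conv_def by (intro arg_cong2[where f = scaleC] integral_cong refl) (simp add: assms)

lemma exp_conv_integrable:
  assumes "continuous_on {0..} f"
  shows "(\<lambda>s. exp (- l * of_real s) *\<^sub>C f s) integrable_on {0..t}"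
  by (intro integrable_continuous_real continuous_intros continuous_on_nonneg_imp_Icc assms) auto

lemma exp_conv_add:
  assumes "continuous_on {0..} f" "continuous_on {0..} g"
  shows "exp_conv l (\<lambda>s. f s + g s) t = exp_conv l f t + exp_conv l g t"
  using integral_add[OF exp_conv_integrable[OF assms(1), of t] exp_conv_integrable[OF assms(2), of t]]
  by (simp add: exp_conv_def scaleC_add_right)

lemma exp_conv_diff:
  assumes "continuous_on {0..} f" "continuous_on {0..} g"
  shows "exp_conv l (\<lambda>s. f s - g s) t = exp_conv l f t - exp_conv l g t"
  using integral_diff[OF exp_conv_integrable[OF assms(1), of t] exp_conv_integrable[OF assms(2), of t]]
  by (simp add: exp_conv_def scaleC_diff_right)

lemma exp_conv_bounded_clinear:
  assumes h: "bounded_linear h" "\<And>c x. h (c *\<^sub>C x) = c *\<^sub>C h x" and "continuous_on {0..} f"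
  shows "exp_conv l (\<lambda>s. h (f s)) t = h (exp_conv l f t)"
proof -
  have "integral {0..t} (\<lambda>s. h (exp (- l * of_real s) *\<^sub>C f s))
      = h (integral {0..t} (\<lambda>s. exp (- l * of_real s) *\<^sub>C f s))"
    by (intro integral_bounded_linear h continuous_intros continuous_on_nonneg_imp_Icc assms) auto
  then show ?thesis by (simp add: exp_conv_def h(2))
qed

lemma exp_conv_scaleC:
  assumes "continuous_on {0..} f"
  shows "exp_conv l (\<lambda>s. c *\<^sub>C f s) t = c *\<^sub>C exp_conv l f t"
  by (rule exp_conv_bounded_clinear[OF bounded_linear_scaleC_right _ assms])
    (simp add: scaleC_scaleC mult.commute)

lemma exp_conv_scalar:
  fixes g :: "real \<Rightarrow> complex"
  assumes "continuous_on {0..} g"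
  shows "exp_conv l (\<lambda>s. g s *\<^sub>C x) t = exp_conv l g t *\<^sub>C x"
proof -
  have "integral {0..t} (\<lambda>s. (exp (- l * of_real s) * g s) *\<^sub>C x)
      = integral {0..t} (\<lambda>s. exp (- l * of_real s) * g s) *\<^sub>C x"
    by (intro integral_bounded_linear[OF bounded_linear_scaleC_left] continuous_intros
        continuous_on_nonneg_imp_Icc assms) auto
  then show ?thesis by (simp add: exp_conv_def scaleC_scaleC scaleC_complex_def)
qed

lemma exp_scaleC_has_vector_derivative:
  assumes "(f has_vector_derivative f') (at s within A)"
  shows "((\<lambda>s. exp (- l * of_real s) *\<^sub>C f s) has_vector_derivative
    (exp (- l * of_real s) *\<^sub>C (f' - l *\<^sub>C f s))) (at s within A)"
proof -
  have "((\<lambda>z. exp (- l * z)) has_field_derivative (- l * exp (- l * of_real s))) (at (of_real s))"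
    by (auto intro!: derivative_eq_intros)
  then have "((\<lambda>s. exp (- l * of_real s)) has_vector_derivative (- l * exp (- l * of_real s))) (at s within A)"
    by (rule has_vector_derivative_real_field)
  from bounded_bilinear.has_vector_derivative[OF bounded_bilinear_scaleC this assms]
  show ?thesis
    by (rule has_vector_derivative_eq_rhs)
      (simp add: scaleC_diff_right scaleC_scaleC scaleC_minus_left mult.commute)
qed

lemma exp_exp_scaleC: "exp (l * of_real t) *\<^sub>C exp (- l * of_real t) *\<^sub>C x = x"
  by (simp add: scaleC_scaleC scaleC_one flip: exp_add)

text \<open>Integrates the derivative of \<open>exp (- l * s) *\<^sub>C V s\<close>, where the
  primitive \<open>V\<close> of \<open>f\<close> vanishes at 0.\<close>

lemma exp_conv_by_parts:
  assumes f: "continuous_on {0..} f" and t: "t \<ge> 0"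
  shows "exp_conv l f t = integral {0..t} f + l *\<^sub>C exp_conv l (\<lambda>s. integral {0..s} f) t"
proof -
  define V where "V s = integral {0..s} f" for s
  have V: "continuous_on {0..} V"
    unfolding V_def[abs_def] by (rule continuous_on_indefinite_integral[OF f])
  have "integral {0..t} (\<lambda>s. exp (- l * of_real s) *\<^sub>C (f s - l *\<^sub>C V s))
      = exp (- l * of_real t) *\<^sub>C V t - exp (- l * of_real 0) *\<^sub>C V 0"
    unfolding V_def
    by (intro integral_FTC exp_scaleC_has_vector_derivative indefinite_integral_has_vector_derivative f t)
  also have "V 0 = 0" by (simp add: V_def)
  finally have "exp_conv l (\<lambda>s. f s + (- l) *\<^sub>C V s) t = V t"
    using exp_exp_scaleC[of t "V t"]
    by (simp add: exp_conv_def scaleC_minus_left scaleC_one)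
  then have "exp_conv l f t + (- l) *\<^sub>C exp_conv l V t = V t"
    using exp_conv_add[OF f, of "\<lambda>s. (- l) *\<^sub>C V s" t] exp_conv_scaleC[OF V, of "- l" t] V
    by (simp add: continuous_intros)
  then show ?thesis
    by (simp add: scaleC_minus_left V_def[abs_def] algebra_simps)
qed

text \<open>The first identity integrates the derivative of \<open>exp (- l * s)\<close> and avoids
  division by \<open>l\<close>, so \<open>l = 0\<close> is covered. The second reflects
  \<open>s\<close> to \<open>t - s\<close> and recognises the integral of the theorem.\<close>

lemma exp_conv_one:
  assumes "t \<ge> 0"
  shows "1 + l * exp_conv l (\<lambda>_. 1) t = exp (l * of_real t)"
    and "exp_conv l (\<lambda>_. 1) t = integral {0..t} (\<lambda>s. exp (l * of_real s))"
proof -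
  have "integral {0..t} (\<lambda>s. exp (- l * of_real s) *\<^sub>C (0 - l *\<^sub>C 1))
      = exp (- l * of_real t) *\<^sub>C 1 - exp (- l * of_real 0) *\<^sub>C (1 :: complex)"
    by (intro integral_FTC exp_scaleC_has_vector_derivative has_vector_derivative_const assms)
  then have "- l * integral {0..t} (\<lambda>s. exp (- l * of_real s)) = exp (- l * of_real t) - 1"
    by (simp add: scaleC_complex_def mult.commute flip: integral_mult_right)
  then have "l * integral {0..t} (\<lambda>s. exp (- l * of_real s)) = 1 - exp (- l * of_real t)"
    by (simp add: algebra_simps)
  moreover have "l * exp_conv l (\<lambda>_. 1) t
      = exp (l * of_real t) * (l * integral {0..t} (\<lambda>s. exp (- l * of_real s)))"
    by (simp add: exp_conv_def scaleC_complex_def)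
  ultimately have "l * exp_conv l (\<lambda>_. 1) t = exp (l * of_real t) * (1 - exp (- l * of_real t))"
    by simp
  then show 1: "1 + l * exp_conv l (\<lambda>_. 1) t = exp (l * of_real t)"
    by (simp add: algebra_simps flip: exp_add)
  show "exp_conv l (\<lambda>_. 1) t = integral {0..t} (\<lambda>s. exp (l * of_real s))"
  proof -
    have "integral {0..t} (\<lambda>s. exp (l * of_real s)) = integral {0..t} (\<lambda>s. exp (l * of_real (t - s)))"
      using Henstock_Kurzweil_Integration.integral_reflect_real[of t 0 "\<lambda>s. exp (l * of_real s)"]
        integral_shift_real_ivl[of "-t" "-t" 0 "\<lambda>s. exp (l * of_real (- s))"]
      by simp
    also have "\<dots> = exp_conv l (\<lambda>_. 1) t"
      by (simp add: exp_conv_def scaleC_complex_def algebra_simps exp_diff exp_minus divide_inverse)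
    finally show ?thesis ..
  qed
qed

text \<open>A factor \<open>exp (l * s)\<close> in the argument reduces the convolution to a plain
  integral: \<open>1 + l * a = exp (l * s)\<close> is convolved to \<open>s * exp (l * s)\<close>,
  and then to the right-hand side. Later \<open>a\<close>, \<open>c\<close>, \<open>e\<close> are
  \<open>j 0\<close>, \<open>j 1\<close>, \<open>j 2\<close>.\<close>

lemma exp_conv_exp:
  fixes a c e :: "real \<Rightarrow> complex"
  defines "a \<equiv> exp_conv l (\<lambda>_. 1)"
  defines "c \<equiv> exp_conv l a"
  defines "e \<equiv> exp_conv l c"
  assumes "t \<ge> 0"
  shows "c t + l * e t = of_real (t\<^sup>2 / 2) * exp (l * of_real t)"
proof -
  have 1: "1 + l * a s = exp (l * of_real s)" if "s \<ge> 0" for s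
    using exp_conv_one(1)[OF that] by (simp add: a_def)
  have a: "continuous_on {0..} a" unfolding a_def by (intro continuous_on_exp_conv continuous_intros)
  have c: "continuous_on {0..} c" unfolding c_def by (intro continuous_on_exp_conv a)
  have 2: "a s + l * c s = of_real s * exp (l * of_real s)" if "s \<ge> 0" for s
  proof -
    have "a s + l * c s = exp_conv l (\<lambda>s. 1 + l *\<^sub>C a s) s"
      using exp_conv_add[of "\<lambda>_. 1" "\<lambda>s. l *\<^sub>C a s" s] exp_conv_scaleC[OF a, of l s] a
      by (simp add: continuous_intros a_def[symmetric] c_def scaleC_complex_def)
    also have "\<dots> = exp_conv l (\<lambda>s. exp (l * of_real s)) s"
      by (rule exp_conv_cong) (simp add: 1 scaleC_complex_def)
    also have "\<dots> = of_real s * exp (l * of_real s)"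
      using that by (simp add: exp_conv_def scaleC_complex_def flip: exp_add)
        (simp add: scaleR_conv_of_real)
    finally show ?thesis .
  qed
  have "c t + l * e t = exp_conv l (\<lambda>s. a s + l *\<^sub>C c s) t"
    using exp_conv_add[OF a, of "\<lambda>s. l *\<^sub>C c s" t] exp_conv_scaleC[OF c, of l t] c
    by (simp add: continuous_intros c_def[symmetric] e_def scaleC_complex_def)
  also have "\<dots> = exp_conv l (\<lambda>s. of_real s * exp (l * of_real s)) t"
    by (rule exp_conv_cong) (simp add: 2 scaleC_complex_def)
  also have "\<dots> = exp (l * of_real t) * integral {0..t} (\<lambda>s. of_real s)"
  proof -
    have "exp (- l * of_real s) *\<^sub>C (of_real s * exp (l * of_real s)) = of_real s" for s :: real
    proof -
      have "exp (- (l * of_real s)) * exp (l * of_real s) = 1" by (simp flip: exp_add)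
      then show ?thesis unfolding scaleC_complex_def by (simp add: mult.left_commute)
    qed
    then show ?thesis by (simp only: exp_conv_def scaleC_complex_def)
  qed
  also have "integral {0..t} (\<lambda>s. of_real s) = (of_real (t\<^sup>2 / 2) :: complex)"
  proof -
    have "integral {0..t} (\<lambda>s. of_real s) = (of_real (t\<^sup>2 / 2) - of_real (0\<^sup>2 / 2) :: complex)"
    proof (rule integral_FTC[OF _ assms(4)])
      fix s :: real
      have "((\<lambda>s. s\<^sup>2 / 2) has_real_derivative s) (at s within {0..})"
        by (auto intro!: derivative_eq_intros)
      then have "((\<lambda>s. s\<^sup>2 / 2) has_vector_derivative s) (at s within {0..})"
        by (simp add: has_real_derivative_iff_has_vector_derivative)
      from bounded_linear.has_vector_derivative[OF bounded_linear_of_real this]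
      show "((\<lambda>s. complex_of_real (s\<^sup>2 / 2)) has_vector_derivative of_real s) (at s within {0..})" .
    qed
    then show ?thesis by simp
  qed
  finally show ?thesis by (simp add: mult.commute)
qed

end

section \<open>The generator of an integrated semigroup\<close>

lemma shift_op_iff: "(x, y) \<in> shift_op T l \<longleftrightarrow> (x, y + l *\<^sub>C x) \<in> T"
  unfolding shift_op_def by force

lemma shift_op_total_op: "shift_op (total_op f) l = total_op (\<lambda>x. f x - l *\<^sub>C x)"
  unfolding shift_op_def total_op_def by auto

section \<open>Nonzero scalar multiples of an operator\<close>

lemma funpow_scaleC:
  fixes f :: "'a::complex_banach \<Rightarrow> 'a"
  assumes "\<And>c x. f (c *\<^sub>C x) = c *\<^sub>C f x"
  shows "((\<lambda>x. a *\<^sub>C f x) ^^ n) x = (a ^ n) *\<^sub>C (f ^^ n) x"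
proof (induction n)
  case (Suc n)
  then show ?case by (simp add: assms scaleC_scaleC mult.commute)
qed (simp add: scaleC_one)

lemma range_funpow_scaleC:
  fixes f :: "'a::complex_banach \<Rightarrow> 'a"
  assumes f: "\<And>c x. f (c *\<^sub>C x) = c *\<^sub>C f x" and a: "a \<noteq> 0"
  shows "range ((\<lambda>x. a *\<^sub>C f x) ^^ n) = range (f ^^ n)"
proof -
  have fn: "(f ^^ n) (c *\<^sub>C x) = c *\<^sub>C (f ^^ n) x" for c x
    by (induction n) (simp_all add: f)
  have "((\<lambda>x. a *\<^sub>C f x) ^^ n) x = (f ^^ n) ((a ^ n) *\<^sub>C x)" for x
    using funpow_scaleC[OF f, where a = a and n = n and x = x] fn by simp
  moreover have "(f ^^ n) x = ((\<lambda>x. a *\<^sub>C f x) ^^ n) (inverse (a ^ n) *\<^sub>C x)" for x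
    using a funpow_scaleC[OF f, where a = a and n = n] fn by (simp add: scaleC_scaleC scaleC_one)
  ultimately show ?thesis by (metis (no_types, lifting) image_subset_iff rangeI subset_antisym)
qed

lemma stable_indices_scaleC:
  assumes f: "\<And>c x. f (c *\<^sub>C x) = c *\<^sub>C f x" and a: "a \<noteq> 0"
  shows "stable_indices (total_op (\<lambda>x. a *\<^sub>C f x)) = stable_indices (total_op f)"
proof -
  have "a *\<^sub>C f x = 0 \<longleftrightarrow> f x = 0" for x
    using a norm_scaleC[of a "f x"] by (metis mult_eq_0_iff norm_eq_zero)
  then show ?thesis
    unfolding stable_indices_def total_op_relpow Range_total_op null_space_total_op
      range_funpow_scaleC[OF f a] by simp
qed

locale nondegenerate_integrated_semigroup =
  fixes S :: "real \<Rightarrow> 'a::complex_banach \<Rightarrow> 'a"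
  assumes S: "integrated_semigroup S" and nondeg: "nondegenerate S"
begin

abbreviation A where "A \<equiv> generator S"

lemma strong_family_S: "strong_family S"
  using S by (simp add: strong_family_def integrated_semigroup_def)

lemmas SD = strong_familyD[OF strong_family_S]

definition V :: "real \<Rightarrow> 'a \<Rightarrow> 'a" where "V t x = integral {0..t} (\<lambda>s. S s x)"

lemma strong_family_V: "strong_family V"
  unfolding V_def[abs_def] by (rule strong_family_integral[OF strong_family_S])

lemmas VD = strong_familyD[OF strong_family_V]

lemma S_0: "S 0 x = 0"
  using S by (simp add: integrated_semigroup_def)

lemma S_commute: "r \<ge> 0 \<Longrightarrow> t \<ge> 0 \<Longrightarrow> S r (S t x) = S t (S r x)"
  using S unfolding integrated_semigroup_def by metis

lemma S_S:
  assumes "r \<ge> 0" "t \<ge> 0"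
  shows "S r (S t x) = V (r + t) x - V t x - V r x"
proof -
  note c = SD(3)[of x]
  have "S r (S t x) = integral {0..r} (\<lambda>\<tau>. S (\<tau> + t) x - S \<tau> x)"
    using S assms unfolding integrated_semigroup_def by metis
  also have "\<dots> = integral {0..r} (\<lambda>\<tau>. S (\<tau> + t) x) - integral {0..r} (\<lambda>\<tau>. S \<tau> x)"
    by (intro integral_diff integrable_continuous_real continuous_on_nonneg_imp_Icc
        continuous_on_shift_nonneg c assms) auto
  finally show ?thesis
    using integral_shift_nonneg[OF c assms(2,1)] by (simp add: V_def)
qed

text \<open>Integrating the defining relation removes the derivative. Membership becomes an equation
  between bounded operators, visibly stable under sums, multiples and integrals.\<close>

lemma generator_iff:
  "(x, y) \<in> A \<longleftrightarrow> (\<forall>r\<ge>0. S r x = r *\<^sub>R x + V r y)"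
proof
  assume xy: "(x, y) \<in> A"
  then obtain D where D: "\<And>t. t \<ge> 0 \<Longrightarrow> ((\<lambda>s. S s x) has_vector_derivative D t) (at t within {0..})"
    by (auto simp: generator_def C1_vectors_def)
  have "((\<lambda>s. S s x) has_vector_derivative (x + S t y)) (at t within {0..})" if t: "t \<ge> 0" for t
  proof -
    have "(\<lambda>s. S s x) differentiable (at t within {0..})"
      using D[OF t] by (auto simp: has_vector_derivative_def differentiable_def)
    moreover have "vector_derivative (\<lambda>s. S s x) (at t within {0..}) = x + S t y"
      using xy t unfolding generator_def by (auto simp: algebra_simps)
    ultimately show ?thesis by (metis vector_derivative_works)
  qed
  then have *: "integral {0..r} (\<lambda>s. x + S s y) = S r x - S 0 x" if "r \<ge> 0" for r
    using that by (rule integral_FTC)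
  have "integral {0..r} (\<lambda>s. x + S s y) = r *\<^sub>R x + V r y" if "r \<ge> 0" for r
    unfolding V_def using that
    by (subst integral_add) (auto intro!: integrable_continuous_real continuous_on_nonneg_imp_Icc SD(3))
  with * show "\<forall>r\<ge>0. S r x = r *\<^sub>R x + V r y" by (simp add: S_0)
next
  assume eq: "\<forall>r\<ge>0. S r x = r *\<^sub>R x + V r y"
  have deriv: "((\<lambda>s. S s x) has_vector_derivative (x + S t y)) (at t within {0..})" if t: "t \<ge> 0" for t
  proof (rule has_vector_derivative_transform[where f = "\<lambda>r. r *\<^sub>R x + V r y"])
    show "((\<lambda>r. r *\<^sub>R x + V r y) has_vector_derivative (x + S t y)) (at t within {0..})"
      unfolding V_def
      by (auto intro!: derivative_eq_intros indefinite_integral_has_vector_derivative[OF SD(3) t])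
  qed (use t eq in auto)
  \<comment> \<open>Nontriviality of the filter makes the derivative within \<open>{0..}\<close>
    unique, also at \<open>t = 0\<close>.\<close>
  have "at t within {0..} \<noteq> bot" if "t \<ge> 0" for t :: real
    unfolding at_within_nonneg_eq[OF that] using that by (subst trivial_limit_within) (simp add: islimpt_Icc)
  then have "vector_derivative (\<lambda>s. S s x) (at t within {0..}) = x + S t y" if "t \<ge> 0" for t
    using that deriv by (intro vector_derivative_within)
  then show "(x, y) \<in> A"
    unfolding generator_def C1_vectors_def using deriv
    by (auto intro!: exI[of _ "\<lambda>t. x + S t y"] continuous_intros SD(3))
qed

lemma generator_add: "(x, y) \<in> A \<Longrightarrow> (x', y') \<in> A \<Longrightarrow> (x + x', y + y') \<in> A"
  by (simp add: generator_iff scaleR_add_right linear_add bounded_linear.linear SD(1) VD(1))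

lemma generator_scaleC: "(x, y) \<in> A \<Longrightarrow> (c *\<^sub>C x, c *\<^sub>C y) \<in> A"
  by (simp add: generator_iff SD(2) VD(2) scaleC_add_right scaleC_scaleC mult.commute
      flip: scaleC_of_real)

text \<open>Closedness of the generator in the form used below: by \<open>generator_iff\<close> the
  bounded operators \<open>S r\<close> and \<open>V r\<close> only have to be pulled through the
  integrals.\<close>

lemma generator_integral:
  fixes f g :: "real \<Rightarrow> 'a"
  assumes f: "continuous_on {0..} f" and g: "continuous_on {0..} g" and t: "t \<ge> 0"
    and fg: "\<And>s. s \<ge> 0 \<Longrightarrow> (f s, g s) \<in> A"
  shows "(integral {0..t} f, integral {0..t} g) \<in> A"
  unfolding generator_iff
proof (intro allI impI)
  fix r :: real assume r: "r \<ge> 0"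
  note c = continuous_on_nonneg_imp_Icc[OF f, of 0 t] continuous_on_nonneg_imp_Icc[OF g, of 0 t]
  have "S r (integral {0..t} f) = integral {0..t} (\<lambda>s. S r (f s))"
    using integral_bounded_linear[OF SD(1)[OF r] c(1)] by simp
  also have "\<dots> = integral {0..t} (\<lambda>s. r *\<^sub>R f s + V r (g s))"
    using fg r by (intro integral_cong) (simp add: generator_iff)
  also have "\<dots> = integral {0..t} (\<lambda>s. r *\<^sub>R f s) + integral {0..t} (\<lambda>s. V r (g s))"
    by (intro integral_add integrable_continuous_real continuous_intros c
        bounded_linear.continuous_on[OF VD(1)[OF r]]) auto
  also have "\<dots> = r *\<^sub>R integral {0..t} f + V r (integral {0..t} g)"
    using integral_bounded_linear[OF VD(1)[OF r] c(2)] by simp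
  finally show "S r (integral {0..t} f) = r *\<^sub>R integral {0..t} f + V r (integral {0..t} g)" .
qed

text \<open>Integrating \<open>S_S\<close> expresses \<open>S r (V t x)\<close> and
  \<open>V r (S t x)\<close> through the primitive \<open>W\<close> of \<open>V\<close>. The
  \<open>W\<close> terms are symmetric in \<open>r\<close> and \<open>t\<close>, so the difference
  is \<open>r *\<^sub>R V t x - t *\<^sub>R V r x\<close>.\<close>

lemma generator_V:
  assumes t: "t \<ge> 0"
  shows "(V t x, S t x - t *\<^sub>R x) \<in> A"
  unfolding generator_iff
proof (intro allI impI)
  fix r :: real assume r: "r \<ge> 0"
  define W where "W s = integral {0..s} (\<lambda>s. V s x)" for s
  have W: "integral {0..p} (\<lambda>s. S q (S s x)) = W (p + q) - W q - W p - p *\<^sub>R V q x"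
    if "p \<ge> 0" "q \<ge> 0" for p q
  proof -
    have i: "(\<lambda>s. V (s + q) x) integrable_on {0..p}" "(\<lambda>s. V s x) integrable_on {0..p}"
      using that by (intro integrable_continuous_real continuous_on_nonneg_imp_Icc
          continuous_on_shift_nonneg VD(3); simp)+
    have "integral {0..p} (\<lambda>s. S q (S s x)) = integral {0..p} (\<lambda>s. V (s + q) x - V s x - V q x)"
      using that by (intro integral_cong) (simp add: S_S add.commute)
    also have "\<dots> = integral {0..p} (\<lambda>s. V (s + q) x) - integral {0..p} (\<lambda>s. V s x) - p *\<^sub>R V q x"
      using that integral_diff[OF integrable_diff[OF i] integrable_const_ivl[of "V q x" 0 p]]
        integral_diff[OF i] by simp
    finally show ?thesis
      using integral_shift_nonneg[OF VD(3) that(2,1), of x] by (simp add: W_def)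
  qed
  note c = continuous_on_nonneg_imp_Icc[OF SD(3), of 0]
  have "S r (V t x) = W (t + r) - W r - W t - t *\<^sub>R V r x"
    using W[OF t r] integral_bounded_linear[OF SD(1)[OF r] c] by (simp add: V_def)
  moreover have "V r (S t x) = W (r + t) - W t - W r - r *\<^sub>R V t x"
  proof -
    have "V r (S t x) = integral {0..r} (\<lambda>s. S t (S s x))"
      unfolding V_def using t by (intro integral_cong) (simp add: S_commute)
    then show ?thesis using W[OF r t] by simp
  qed
  moreover have "V r (S t x - t *\<^sub>R x) = V r (S t x) - t *\<^sub>R V r x"
    using VD(1)[OF r] by (simp add: linear_diff linear_scale bounded_linear.linear)
  ultimately show "S r (V t x) = r *\<^sub>R V t x + V r (S t x - t *\<^sub>R x)"
    by (simp add: add.commute)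
qed

lemma generator_S:
  assumes "(x, y) \<in> A" and s: "s \<ge> 0"
  shows "(S s x, S s y) \<in> A"
  unfolding generator_iff
proof (intro allI impI)
  fix r :: real assume r: "r \<ge> 0"
  have "V r (S s y) = integral {0..r} (\<lambda>q. S s (S q y))"
    unfolding V_def using s by (intro integral_cong) (simp add: S_commute)
  also have "\<dots> = S s (V r y)"
    unfolding V_def by (intro integral_bounded_linear SD(1) s continuous_on_nonneg_imp_Icc SD(3)) simp
  finally have "V r (S s y) = S s (V r y)" .
  moreover have "S r (S s x) = S s (r *\<^sub>R x + V r y)"
    using assms(1) r unfolding S_commute[OF r s] generator_iff by simp
  ultimately show "S r (S s x) = r *\<^sub>R S s x + V r (S s y)"
    using SD(1)[OF s] by (simp add: linear_add linear_scale bounded_linear.linear)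
qed

section \<open>The shifted generator and iterated convolutions\<close>

context
  fixes l :: complex
begin

definition T where "T = shift_op A l"

lemma T_iff: "(x, y) \<in> T \<longleftrightarrow> (x, y + l *\<^sub>C x) \<in> A"
  by (simp add: T_def shift_op_iff)

lemma T_add: "(x, y) \<in> T \<Longrightarrow> (x', y') \<in> T \<Longrightarrow> (x + x', y + y') \<in> T"
  unfolding T_iff using generator_add[of x "y + l *\<^sub>C x" x' "y' + l *\<^sub>C x'"]
  by (simp add: scaleC_add_right algebra_simps)

lemma T_scaleC: "(x, y) \<in> T \<Longrightarrow> (c *\<^sub>C x, c *\<^sub>C y) \<in> T"
  unfolding T_iff using generator_scaleC[of x "y + l *\<^sub>C x" c]
  by (simp add: scaleC_add_right scaleC_scaleC mult.commute)

lemma subspace_T: "subspace T"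
proof (rule subspaceI)
  show "0 \<in> T"
    unfolding zero_prod_def T_iff generator_iff
    using linear_0[OF bounded_linear.linear[OF SD(1)]] linear_0[OF bounded_linear.linear[OF VD(1)]]
    by (simp add: scaleC_zero_right)
  show "p + q \<in> T" if "p \<in> T" "q \<in> T" for p q
    using that T_add by (cases p; cases q) auto
  show "c *\<^sub>R p \<in> T" if "p \<in> T" for c p
    using that T_scaleC[of _ _ "of_real c"] by (cases p) (auto simp: scaleC_of_real)
qed

lemma single_valued_T: "single_valued T"
  using single_valued_generator[OF S nondeg]
  by (auto simp: single_valued_def T_iff) (metis add_right_cancel)

lemma T_S: "(x, y) \<in> T \<Longrightarrow> s \<ge> 0 \<Longrightarrow> (S s x, S s y) \<in> T"
  unfolding T_iff using generator_S[of x "y + l *\<^sub>C x" s]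
  by (simp add: SD(2) linear_add bounded_linear.linear[OF SD(1)])

lemma generator_exp_conv:
  fixes f g :: "real \<Rightarrow> 'a"
  assumes f: "continuous_on {0..} f" and g: "continuous_on {0..} g" and t: "t \<ge> 0"
    and fg: "\<And>s. s \<ge> 0 \<Longrightarrow> (f s, g s) \<in> A"
  shows "(exp_conv l f t, exp_conv l g t) \<in> A"
  unfolding exp_conv_def
  by (intro generator_scaleC generator_integral continuous_intros continuous_on_exp f g t fg)

lemma T_exp_conv:
  fixes f g :: "real \<Rightarrow> 'a"
  assumes f: "continuous_on {0..} f" and g: "continuous_on {0..} g" and t: "t \<ge> 0"
    and fg: "\<And>s. s \<ge> 0 \<Longrightarrow> (f s, g s) \<in> T"
  shows "(exp_conv l f t, exp_conv l g t) \<in> T"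
proof -
  have lf: "continuous_on {0..} (\<lambda>s. l *\<^sub>C f s)" by (intro continuous_intros f)
  have "(exp_conv l f t, exp_conv l (\<lambda>s. g s + l *\<^sub>C f s) t) \<in> A"
    using fg by (intro generator_exp_conv continuous_intros f g t) (simp add: T_iff)
  then show ?thesis
    by (simp add: T_iff exp_conv_add[OF g lf] exp_conv_scaleC[OF f])
qed

text \<open>The separate type \<open>'b\<close> lets one definition serve the orbits in
  \<open>J\<close> and the scalar functions in \<open>j\<close>.\<close>

definition iter_conv :: "(real \<Rightarrow> 'b::complex_banach) \<Rightarrow> nat \<Rightarrow> real \<Rightarrow> 'b" where
  "iter_conv f n = (exp_conv l ^^ n) f"

lemma iter_conv_Suc: "iter_conv f (Suc n) = exp_conv l (iter_conv f n)"
  by (simp add: iter_conv_def)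

lemma continuous_on_iter_conv: "continuous_on {0..} f \<Longrightarrow> continuous_on {0..} (iter_conv f n)"
  by (induction n) (simp_all add: iter_conv_def continuous_on_exp_conv)

definition J :: "nat \<Rightarrow> real \<Rightarrow> 'a \<Rightarrow> 'a" where "J n t x = iter_conv (\<lambda>s. S s x) n t"

lemma J_0: "J 0 = S"
  by (simp add: J_def[abs_def] iter_conv_def)

lemma J_Suc: "J (Suc n) t x = exp_conv l (\<lambda>s. J n s x) t"
  by (simp add: J_def iter_conv_Suc)

lemma strong_family_J: "strong_family (J n)"
proof (induction n)
  case (Suc n)
  have "J (Suc n) = (\<lambda>t x. exp_conv l (\<lambda>s. J n s x) t)"
    by (intro ext) (rule J_Suc)
  then show ?case using strong_family_exp_conv[OF Suc] by simp
qed (simp add: J_0 strong_family_S)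

lemmas JD = strong_familyD[OF strong_family_J]

text \<open>The index is shifted because \<open>S\<close> counts as once integrated: the scalar
  partner of \<open>J 0 = S\<close> is the first convolution of 1, which is the integral in the
  theorem.\<close>

definition j :: "nat \<Rightarrow> real \<Rightarrow> complex" where "j n = iter_conv (\<lambda>_. 1) (Suc n)"

lemma continuous_on_j: "continuous_on {0..} (j n)"
  unfolding j_def by (intro continuous_on_iter_conv continuous_intros)

lemma T_J_S: "t \<ge> 0 \<Longrightarrow> (x, y) \<in> T \<Longrightarrow> (J n t x, J n t y) \<in> T"
proof (induction n arbitrary: t)
  case (Suc n)
  then show ?case
    unfolding J_Suc by (intro T_exp_conv JD(3))
qed (simp add: J_0 T_S)

text \<open>For \<open>n = 0\<close>, integration by parts splits \<open>J 1\<close> into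
  \<open>V\<close> plus \<open>l\<close> times its convolution, and \<open>generator_V\<close>
  handles both; the scalars combine by the same formula for the constant 1. The induction step
  convolves, since \<open>T\<close> passes through \<open>exp_conv\<close>.\<close>

lemma T_J:
  assumes "t \<ge> 0"
  shows "(J (Suc n) t x, J n t x - j n t *\<^sub>C x) \<in> T"
  using assms
proof (induction n arbitrary: t)
  case 0
  define c where "c = exp_conv l (\<lambda>s. complex_of_real s) t"
  have cid: "continuous_on {0..} complex_of_real" by (intro continuous_intros)
  have parts: "J 1 t x = V t x + l *\<^sub>C exp_conv l (\<lambda>s. V s x) t"
    using exp_conv_by_parts[OF SD(3) 0, of l x] by (simp add: J_Suc J_0 V_def)
  have "(exp_conv l (\<lambda>s. V s x) t, exp_conv l (\<lambda>s. S s x - s *\<^sub>R x) t) \<in> A"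
    by (intro generator_exp_conv continuous_intros VD(3) SD(3) 0 generator_V)
  moreover have "exp_conv l (\<lambda>s. S s x - s *\<^sub>R x) t = J 1 t x - c *\<^sub>C x"
  proof -
    have "exp_conv l (\<lambda>s. S s x - of_real s *\<^sub>C x) t
        = J 1 t x - exp_conv l (\<lambda>s. of_real s *\<^sub>C x) t"
      unfolding One_nat_def J_Suc J_0 by (intro exp_conv_diff continuous_intros SD(3))
    then show ?thesis
      using exp_conv_scalar[OF cid, where l = l and x = x and t = t]
      by (simp add: c_def scaleC_of_real)
  qed
  ultimately have "(V t x + l *\<^sub>C exp_conv l (\<lambda>s. V s x) t,
      (S t x - t *\<^sub>R x) + l *\<^sub>C (J 1 t x - c *\<^sub>C x)) \<in> A"
    using generator_add[OF generator_V[OF 0] generator_scaleC] by simp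
  then have "(J 1 t x, (S t x - t *\<^sub>R x) + l *\<^sub>C (J 1 t x - c *\<^sub>C x)) \<in> A"
    by (simp only: parts)
  moreover have "j 0 t = of_real t + l * c"
  proof -
    have "continuous_on {0..} (\<lambda>_::real. 1::complex)" by (intro continuous_intros)
    from exp_conv_by_parts[OF this 0, of l]
    have "j 0 t = integral {0..t} (\<lambda>_. 1) + l *\<^sub>C exp_conv l (\<lambda>s. integral {0..s} (\<lambda>_. 1)) t"
      by (simp add: j_def iter_conv_def)
    also have "exp_conv l (\<lambda>s. integral {0..s} (\<lambda>_. 1)) t = c"
      unfolding c_def by (rule exp_conv_cong) (simp add: scaleR_conv_of_real)
    finally show ?thesis using 0 by (simp add: scaleC_complex_def scaleR_conv_of_real)
  qed
  then have "(S t x - t *\<^sub>R x) + l *\<^sub>C (J 1 t x - c *\<^sub>C x) = S t x - j 0 t *\<^sub>C x + l *\<^sub>C J 1 t x"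
    by (simp add: scaleC_diff_right scaleC_add_left scaleC_scaleC flip: scaleC_of_real)
  ultimately have "(J 1 t x, S t x - j 0 t *\<^sub>C x + l *\<^sub>C J 1 t x) \<in> A"
    by (simp only:)
  then show ?case by (simp add: T_iff J_0)
next
  case (Suc n)
  have "(exp_conv l (\<lambda>s. J (Suc n) s x) t, exp_conv l (\<lambda>s. J n s x - j n s *\<^sub>C x) t) \<in> T"
    by (intro T_exp_conv continuous_intros JD(3) continuous_on_j Suc)
  moreover have "exp_conv l (\<lambda>s. J n s x - j n s *\<^sub>C x) t = J (Suc n) t x - j (Suc n) t *\<^sub>C x"
  proof -
    have "exp_conv l (\<lambda>s. J n s x - j n s *\<^sub>C x) t
        = J (Suc n) t x - exp_conv l (\<lambda>s. j n s *\<^sub>C x) t"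
      unfolding J_Suc by (intro exp_conv_diff continuous_intros JD(3) continuous_on_j)
    moreover have "exp_conv l (j n) t = j (Suc n) t"
      by (simp add: j_def iter_conv_Suc)
    ultimately show ?thesis
      by (simp add: exp_conv_scalar[OF continuous_on_j])
  qed
  ultimately show ?case by (simp add: J_Suc)
qed

text \<open>\<open>j 1 t = 0\<close> means that \<open>l\<close> is a double zero of \<open>z \<mapsto> \<integral>\<^sub>0\<^sup>t e\<^sup>z\<^sup>s ds - j 0 t\<close>; then \<open>S t - j 0 t\<close>
  contains the factor \<open>(A - l)\<^sup>2\<close>, otherwise it contains \<open>A - l\<close> exactly once.\<close>

lemma quasi_Fredholm_T:
  assumes t: "t > 0" and qF: "quasi_Fredholm (total_op (\<lambda>x. S t x - j 0 t *\<^sub>C x))"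
  shows "quasi_Fredholm T"
proof -
  define B where "B x = S t x - j 0 t *\<^sub>C x" for x
  have t0: "t \<ge> 0" using t by simp
  have B_scaleC: "B (c *\<^sub>C x) = c *\<^sub>C B x" for c x
    by (simp add: B_def SD(2)[OF t0] scaleC_diff_right scaleC_scaleC mult.commute)
  obtain d where d: "dis (total_op B) = enat d" "\<And>n. n \<ge> d \<Longrightarrow> closed (range (B ^^ n))"
    using qF by (auto simp: quasi_Fredholm_def B_def[abs_def] total_op_relpow Range_total_op)
  have dst: "d \<in> stable_indices (total_op B)"
  proof -
    have "stable_indices (total_op B) \<noteq> {}"
      using d(1) dis_eq_infinity by fastforce
    from dis_in_stable_indices[OF this] show ?thesis using d(1) by auto
  qed
  have reduce: "quasi_Fredholm T"
    if a: "a \<noteq> 0" and fac: "factored_operator T E F C (\<lambda>x. a *\<^sub>C B x) k" for a E F C k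
    using factored_operator.quasi_Fredholm_if_factor[OF fac, of d] dst d(2)
    by (simp add: stable_indices_scaleC[OF B_scaleC a] range_funpow_scaleC[OF B_scaleC a])
  have TJ: "(J (Suc n) t x, J n t x - j n t *\<^sub>C x) \<in> T" for n x
    by (rule T_J[OF t0])
  have bl: "bounded_linear (\<lambda>x. a *\<^sub>C J n t x)" for a n
    by (intro bounded_linear_compose[OF bounded_linear_scaleC_right] JD(1) t0)
  have TB: "(J 1 t x, B x) \<in> T" for x
    using TJ[of 0 x] by (simp add: B_def J_0)
  note maps = T_scaleC[OF T_J_S[OF t0]]
  show ?thesis
  proof (cases "j 1 t = 0")
    case False
    \<comment> \<open>Dividing by \<open>j 1 t\<close> turns \<open>T_J\<close> for
      \<open>n = 1\<close> into the normalised form \<open>T F = E - I\<close>.\<close>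
    define a where "a = inverse (j 1 t)"
    have a: "a \<noteq> 0" "a * j 1 t = 1" using False by (simp_all add: a_def)
    have "factored_operator T (\<lambda>x. a *\<^sub>C J 1 t x) (\<lambda>x. a *\<^sub>C J 2 t x)
        (\<lambda>x. a *\<^sub>C B x) (\<lambda>x. a *\<^sub>C B x) 1"
    proof (rule factored_operator.intro)
      show "(a *\<^sub>C J 2 t x, a *\<^sub>C J 1 t x - x) \<in> T" for x
        using T_scaleC[OF TJ[of 1 x, unfolded Suc_1], of a]
        by (simp only: scaleC_diff_right scaleC_scaleC a(2) scaleC_one)
      show "(a *\<^sub>C J 1 t x, a *\<^sub>C B x) \<in> T" "(a *\<^sub>C J 1 t x, a *\<^sub>C B x) \<in> T ^^ 1" for x
        using T_scaleC[OF TB] by simp_all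
      show "bounded_linear (\<lambda>x. a *\<^sub>C B x)"
        unfolding B_def
        by (intro bounded_linear_compose[OF bounded_linear_scaleC_right] bounded_linear_sub SD(1) t0
            bounded_linear_scaleC_right)
    qed (use maps bl subspace_T single_valued_T in auto)
    then show ?thesis by (rule reduce[OF a(1)])
  next
    case True
    \<comment> \<open>The right-hand side is nonzero for \<open>t > 0\<close>, so
      \<open>j 2 t\<close> takes over as the normalising scalar.\<close>
    have "j 1 t + l * j 2 t = of_real (t\<^sup>2 / 2) * exp (l * of_real t)"
      using exp_conv_exp[OF t0, of l] by (simp add: j_def iter_conv_def numeral_2_eq_2)
    then have "j 2 t \<noteq> 0" using True t by auto
    define a where "a = inverse (j 2 t)"
    have a: "a \<noteq> 0" "a * j 2 t = 1" using \<open>j 2 t \<noteq> 0\<close> by (simp_all add: a_def)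
    \<comment> \<open>The scalar term of \<open>T_J\<close> vanishes, so \<open>T\<close> leads from
      \<open>J 2\<close> to \<open>J 1\<close> and on to \<open>B\<close>; hence
      \<open>k = 2\<close>.\<close>
    have TJ2: "(J 2 t x, J 1 t x) \<in> T" for x
      using TJ[of 1 x, unfolded Suc_1 True] by (simp add: scaleC_zero_left)
    have "factored_operator T (\<lambda>x. a *\<^sub>C J 2 t x) (\<lambda>x. a *\<^sub>C J 3 t x)
        (\<lambda>x. a *\<^sub>C J 1 t x) (\<lambda>x. a *\<^sub>C B x) 2"
    proof (rule factored_operator.intro)
      show "(a *\<^sub>C J 3 t x, a *\<^sub>C J 2 t x - x) \<in> T" for x
        using T_scaleC[OF TJ[of 2 x], of a]
        by (simp add: scaleC_diff_right scaleC_scaleC a(2) scaleC_one)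
      show "(a *\<^sub>C J 2 t x, a *\<^sub>C J 1 t x) \<in> T" for x
        using T_scaleC[OF TJ2] .
      show "(a *\<^sub>C J 2 t x, a *\<^sub>C B x) \<in> T ^^ 2" for x
        using relpow_trans[of _ _ 1 T _ 1, unfolded relpow_1 one_add_one, OF T_scaleC[OF TJ2] T_scaleC[OF TB]] .
    qed (use maps bl subspace_T single_valued_T in auto)
    then show ?thesis by (rule reduce[OF a(1)])
  qed
qed

end

end

theorem theorem3p1:
  fixes S :: "real \<Rightarrow> 'a::complex_banach \<Rightarrow> 'a" and t :: real
  assumes "integrated_semigroup S"
    and "nondegenerate S"
    and "t > 0"
  shows "{integral {0..t} (\<lambda>s. exp (l * complex_of_real s)) | l. l \<in> qF_spectrum (generator S)}
           \<subseteq> qF_spectrum (total_op (S t))"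
proof safe
  fix l assume l: "l \<in> qF_spectrum (generator S)"
  interpret nondegenerate_integrated_semigroup S
    using assms by unfold_locales
  have "integral {0..t} (\<lambda>s. exp (l * complex_of_real s)) = j l 0 t"
    using exp_conv_one(2)[of t l] assms(3) by (simp add: j_def iter_conv_def)
  moreover have "\<not> quasi_Fredholm (T l)"
    using l by (simp add: qF_spectrum_def T_def)
  ultimately show "integral {0..t} (\<lambda>s. exp (l * complex_of_real s)) \<in> qF_spectrum (total_op (S t))"
    using quasi_Fredholm_T[OF assms(3)] by (auto simp: qF_spectrum_def shift_op_total_op)
qed

end
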